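(* Let $d\ge 2$. There are constants $V_0>0$ and $c>0$, depending only on $d$, such that for every real $V>V_0$ with $d!\,V\in\mathbb{Z}$, $$V^{(d-1)/(d+1)}\le c\,\log N_d(V).$$
   Context: A convex lattice polytope in $\mathbb{R}^d$ is a convex polytope all of whose vertices belong to $\mathbb{Z}^d$. Two convex lattice polytopes are equivalent if one can be carried to the other by a lattice preserving affine transformation, i.e. an affine bijection $T:\mathbb{R}^d\to\mathbb{R}^d$ with $T(\mathbb{Z}^d)=\mathbb{Z}^d$. This is an equivalence relation, and equivalent polytopes have the same volume. For $V>0$ with $d!\,V$ a positive integer, $N_d(V)$ denotes the number of equivalence classes of convex lattice polytopes in $\mathbb{R}^d$ of ($d$-dimensional) volume $V$. *)

theory Defs
  imports "HOL-Analysis.Analysis"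
begin

definition integer_lattice :: "(real ^ 'n) set" where
  "integer_lattice = {x. \<forall>i. x $ i \<in> \<int>}"

definition lattice_polytope :: "(real ^ 'n) set \<Rightarrow> bool" where
  "lattice_polytope P \<longleftrightarrow> polytope P \<and> {x. x extreme_point_of P} \<subseteq> integer_lattice"

definition lattice_preserving_affine :: "(real ^ 'n \<Rightarrow> real ^ 'n) \<Rightarrow> bool" where
  "lattice_preserving_affine T \<longleftrightarrow>
     (\<exists>A b. linear A \<and> T = (\<lambda>x. A x + b)) \<and> bij T \<and> T ` integer_lattice = integer_lattice"

definition lattice_equivalence :: "((real ^ 'n) set \<times> (real ^ 'n) set) set" where
  "lattice_equivalence = {(P, Q). lattice_polytope P \<and> lattice_polytope Q \<and>
     (\<exists>T. lattice_preserving_affine T \<and> T ` P = Q)}"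

lemma lattice_preserving_affine_id: "lattice_preserving_affine (\<lambda>x. x)"
  unfolding lattice_preserving_affine_def
  by (auto simp: bij_id[unfolded id_def] intro!: exI[of _ "\<lambda>x. x"] exI[of _ 0] linear_id[unfolded id_def])

lemma lattice_preserving_affine_comp:
  assumes "lattice_preserving_affine S" "lattice_preserving_affine T"
  shows "lattice_preserving_affine (S \<circ> T)"
proof -
  obtain A a B b where S: "linear A" "S = (\<lambda>x. A x + a)" and T: "linear B" "T = (\<lambda>x. B x + b)"
    using assms unfolding lattice_preserving_affine_def by blast
  have "S \<circ> T = (\<lambda>x. (A \<circ> B) x + (A b + a))"
    using S T by (auto simp: linear_add)
  moreover have "linear (A \<circ> B)"
    using S T by (simp add: linear_compose)
  moreover have "bij (S \<circ> T)" "(S \<circ> T) ` integer_lattice = integer_lattice"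
    using assms by (auto simp: lattice_preserving_affine_def bij_comp simp flip: image_image)
  ultimately show ?thesis
    unfolding lattice_preserving_affine_def by blast
qed

lemma lattice_preserving_affine_inv:
  assumes "lattice_preserving_affine T"
  shows "lattice_preserving_affine (inv T)"
proof -
  obtain A b where T: "linear A" "T = (\<lambda>x. A x + b)" and "bij T"
    and Z: "T ` integer_lattice = integer_lattice"
    using assms unfolding lattice_preserving_affine_def by blast
  have "inj A"
    using bij_is_inj[OF \<open>bij T\<close>] unfolding T(2) inj_def by simp
  then obtain B where B: "linear B" "\<And>x. A (B x) = x"
    using linear_injective_isomorphism T(1) by blast
  have "inv T = (\<lambda>y. B y + - B b)"
  proof
    fix y
    have "T (B y + - B b) = y"
      using T B by (simp add: linear_diff)
    then show "inv T y = B y + - B b"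
      using \<open>bij T\<close> by (metis bij_is_inj inv_f_f)
  qed
  moreover have "inv T ` integer_lattice = integer_lattice"
    using Z \<open>bij T\<close> by (metis bij_is_inj image_inv_f_f)
  ultimately show ?thesis
    using B(1) bij_imp_bij_inv[OF \<open>bij T\<close>] unfolding lattice_preserving_affine_def by blast
qed

lemma equiv_lattice_equivalence:
  "equiv (Collect lattice_polytope) (lattice_equivalence :: ((real ^ 'n) set \<times> _) set)"
proof (rule equivI)
  show "(lattice_equivalence :: ((real ^ 'n) set \<times> _) set) \<subseteq> Collect lattice_polytope \<times> Collect lattice_polytope"
    by (auto simp: lattice_equivalence_def)
  show "refl_on (Collect lattice_polytope) (lattice_equivalence :: ((real ^ 'n) set \<times> _) set)"
    using lattice_preserving_affine_id by (force simp: refl_on_def lattice_equivalence_def)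
  show "sym (lattice_equivalence :: ((real ^ 'n) set \<times> _) set)"
  proof (rule symI)
    fix P Q :: "(real ^ 'n) set"
    assume "(P, Q) \<in> lattice_equivalence"
    then obtain T where T: "lattice_preserving_affine T" "T ` P = Q" "lattice_polytope P" "lattice_polytope Q"
      by (auto simp: lattice_equivalence_def)
    then have "inv T ` Q = P"
      by (metis bij_is_inj image_inv_f_f lattice_preserving_affine_def)
    then show "(Q, P) \<in> lattice_equivalence"
      using T lattice_preserving_affine_inv unfolding lattice_equivalence_def by blast
  qed
  show "trans (lattice_equivalence :: ((real ^ 'n) set \<times> _) set)"
  proof (rule transI)
    fix P Q R :: "(real ^ 'n) set"
    assume "(P, Q) \<in> lattice_equivalence" "(Q, R) \<in> lattice_equivalence"
    then obtain S T where "lattice_polytope P" "lattice_polytope R" "lattice_preserving_affine S"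
      "lattice_preserving_affine T" "(S \<circ> T) ` P = R"
      by (auto simp: lattice_equivalence_def image_comp)
    then show "(P, R) \<in> lattice_equivalence"
      using lattice_preserving_affine_comp unfolding lattice_equivalence_def by blast
  qed
qed

text \<open>The type argument fixes the dimension \<open>d = CARD('n)\<close>. Since \<open>card\<close> is \<open>0\<close> on infinite sets,
  reading this as the number of classes relies on there being finitely many of them when \<open>V > 0\<close>.\<close>

definition num_lattice_polytopes :: "'n::finite itself \<Rightarrow> real \<Rightarrow> nat" where
  "num_lattice_polytopes TYPE('n) V =
     card ({P :: (real ^ 'n) set. lattice_polytope P \<and> measure lebesgue P = V} // lattice_equivalence)"

end

theory Submission
  imports Defs "HOL-Real_Asymp.Real_Asymp"
begin

text \<open>
  Write \<open>d = CARD('n)\<close> and \<open>D = d! V\<close>, and single out one coordinate \<open>k\<close> as height. The paraboloid supplies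
  the many polytopes. Over the \<open>m\<^sup>d\<^sup>-\<^sup>1\<close> points \<open>x\<close> of a grid of side about \<open>m\<close> in the other coordinates, the
  lattice points \<open>(x, \<bar>x\<bar>\<^sup>2)\<close> are in convex position, and they fit into a box of volume of order
  \<open>m\<^sup>d\<^sup>-\<^sup>1 \<cdot> m\<^sup>2 = m\<^sup>d\<^sup>+\<^sup>1\<close>. With \<open>m\<close> of order \<open>V\<close> to the power \<open>1/(d+1)\<close>, the number of these points is of order \<open>V\<close> to
  the power \<open>(d-1)/(d+1)\<close>, and each of them may independently be kept or cut off.

  The volume has to come out as exactly \<open>V\<close>. The convex hull of the lattice points above the paraboloid is
  bounded below by the function that interpolates each \<open>x\<^sub>i\<^sup>2\<close> linearly between integers, and its volume, up
  to a flat top at height \<open>H\<close>, is computed cube by cube (\<open>chord_region_volume\<close>). Cutting off one lattice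
  point removes a pyramid of volume \<open>2\<^sup>d\<^sup>-\<^sup>1/d!\<close>, whichever point it is (\<open>measure_tip\<close>); for points with
  even coordinates these pyramids do not interfere, so a set \<open>T\<close> of such points may be cut off
  (\<open>dented_region\<close>). One unit of \<open>H\<close> changes \<open>d!\<close> times the volume by \<open>K\<close>, of order \<open>m\<^sup>d\<^sup>-\<^sup>1\<close>, so a
  suitable \<open>H\<close> overshoots \<open>D\<close> by some \<open>r \<le> K\<close>. Writing \<open>r\<close> in base \<open>m\<close>, the digit \<open>t\<close> of \<open>m\<^sup>j\<close> is removed by
  cutting a simplex with \<open>j\<close> legs \<open>m\<close>, one leg \<open>t\<close> and the other legs \<open>1\<close> off a corner of the top
  (\<open>trim_corners\<close>); the top has at least \<open>d\<close> corners, one for each digit. All cuts are instances of one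
  principle (\<open>lattice_polytope_cuts\<close>): a half-space cuts a lattice polytope in a lattice polytope as soon
  as the new face is one.

  This gives \<open>2\<close> to the power \<open>m\<^sup>d\<^sup>-\<^sup>1\<close> polytopes of volume exactly \<open>V\<close> in a cube of side of order \<open>D\<close>
  (\<open>many_lattice_polytopes\<close>). An equivalence between two of them is determined by the images of \<open>d + 1\<close>
  lattice points that lie in all of them, so each class contains only polynomially many, in \<open>D\<close>, members of
  the family (\<open>card_family_le_num_lattice_polytopes\<close>), and the logarithm of that polynomial is negligible.

  Since \<open>card\<close> of an infinite set is \<open>0\<close>, the count also needs the set of classes to be finite
  (\<open>finite_lattice_polytope_classes\<close>). Relative to a largest simplex on its vertices, a polytope has
  barycentric coordinates in \<open>[-1, 1]\<close> whose denominators are bounded in terms of the volume, and these data,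
  together with the position of the lattice in the same coordinates, determine the class.
\<close>

section \<open>Volumes of affine images\<close>

text \<open>It suffices to consider stretchings, swaps of coordinates and transvections. The determinant of a transvection is
  obtained from a row operation, which makes sense without an order on the index type.\<close>

lemma linear_image_scales_measure:
  fixes f :: "real ^ 'n \<Rightarrow> real ^ 'n"
  assumes "linear f" "S \<in> lmeasurable"
  shows "f ` S \<in> lmeasurable \<and> measure lebesgue (f ` S) = \<bar>det (matrix f)\<bar> * measure lebesgue S"
proof -
  define Q where "Q f \<longleftrightarrow> (\<forall>S \<in> lmeasurable. f ` S \<in> lmeasurable
      \<and> measure lebesgue (f ` S) = \<bar>det (matrix f)\<bar> * measure lebesgue S)"
    for f :: "real ^ 'n \<Rightarrow> real ^ 'n"
  have boxes: "Q f" if "linear f" "\<bar>det (matrix f)\<bar> = 1"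
    "\<And>a b. cbox a b \<noteq> {} \<Longrightarrow> measure lebesgue (f ` cbox a b) = measure lebesgue (cbox a b)" for f
    unfolding Q_def
  proof
    fix S :: "(real ^ 'n) set" assume "S \<in> lmeasurable"
    have "measure lebesgue (f ` cbox a b) = 1 * measure lebesgue (cbox a b)" for a b
      using that(3)[of a b] by (cases "cbox a b = {}") auto
    from measure_linear_sufficient[OF that(1) \<open>S \<in> lmeasurable\<close> this]
    show "f ` S \<in> lmeasurable \<and> measure lebesgue (f ` S) = \<bar>det (matrix f)\<bar> * measure lebesgue S"
      using that(2) by simp
  qed
  have "Q f"
  proof (rule induct_linear_elementary[OF \<open>linear f\<close>])
    fix f g :: "real ^ 'n \<Rightarrow> real ^ 'n"
    assume "linear f" "linear g" "Q f" "Q g"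
    then show "Q (f \<circ> g)"
      by (simp add: Q_def matrix_compose det_mul abs_mult flip: image_image image_comp)
  next
    fix f :: "real ^ 'n \<Rightarrow> real ^ 'n" and i
    assume "linear f" and 0: "\<And>x. f x $ i = 0"
    have "\<not> surj f"
      using 0 by (metis surjD vec_component zero_neq_one)
    then have "\<not> inj f"
      using \<open>linear f\<close> linear_injective_imp_surjective by blast
    then have "det (matrix f) = 0" "negligible (f ` S)" for S
      using \<open>linear f\<close> det_nz_iff_inj negligible_linear_singular_image by blast+
    then show "Q f"
      by (auto simp: Q_def negligible_imp_measurable negligible_imp_measure0)
  next
    fix c
    show "Q (\<lambda>x. \<chi> i. c i * x $ i)"
      by (simp add: Q_def measurable_stretch measure_stretch axis_def matrix_def det_diagonal)
  next
    fix m n :: 'n assume "m \<noteq> n"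
    let ?p = "Transposition.transpose m n"
    let ?h = "\<lambda>x::real ^ 'n. \<chi> i. x $ ?p i"
    have lin: "linear ?h"
      by (rule linearI) (simp_all add: vec_eq_iff)
    have "matrix ?h = (\<chi> i. mat 1 $ ?p i)"
      by (simp add: matrix_def vec_eq_iff axis_def mat_def)
    then have det: "\<bar>det (matrix ?h)\<bar> = 1"
      by (simp add: det_permute_rows permutes_swap_id sign_swap_id abs_mult)
    have img: "?h ` cbox a b = cbox (?h a) (?h b)" for a b
    proof
      show "cbox (?h a) (?h b) \<subseteq> ?h ` cbox a b"
      proof
        fix y assume "y \<in> cbox (?h a) (?h b)"
        then have "y $ ?p i \<in> {a $ i..b $ i}" for i
          by (auto simp: mem_box_cart dest: spec[of _ "?p i"])
        then have "?h y \<in> cbox a b" "?h (?h y) = y"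
          by (auto simp: mem_box_cart vec_eq_iff)
        then show "y \<in> ?h ` cbox a b" by (metis imageI)
      qed
    qed (auto simp: mem_box_cart)
    have "measure lebesgue (?h ` cbox a b) = measure lebesgue (cbox a b)" if "cbox a b \<noteq> {}" for a b
    proof -
      have "cbox (?h a) (?h b) \<noteq> {}" using that img[of a b] by auto
      moreover have "(\<Prod>i\<in>UNIV. (b - a) $ ?p i) = (\<Prod>i\<in>UNIV. (b - a) $ i)"
        using prod.permute[OF permutes_swap_id[of m UNIV n], of "\<lambda>i. (b - a) $ i"] by (simp add: o_def)
      ultimately show ?thesis
        using that by (simp add: img content_cbox_cart)
    qed
    with lin det show "Q ?h" by (intro boxes)
  next
    fix m n :: 'n assume "m \<noteq> n"
    let ?h = "\<lambda>x::real ^ 'n. \<chi> i. if i = m then x $ m + x $ n else x $ i"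
    have lin: "linear ?h"
      by (rule linearI) (auto simp: vec_eq_iff algebra_simps)
    have "matrix ?h = (\<chi> k. if k = m then row m (mat 1) + 1 *s row n (mat 1) else row k (mat 1))"
      by (auto simp: matrix_def vec_eq_iff axis_def mat_def row_def)
    then have det: "det (matrix ?h) = 1"
      using det_row_operation[OF \<open>m \<noteq> n\<close>, of "mat 1" 1] by simp
    have "measure lebesgue (?h ` cbox a b) = measure lebesgue (cbox a b)" if "cbox a b \<noteq> {}" for a b
    proof -
      \<comment> \<open>The volume of a sheared box is known if the box starts at \<open>0\<close> in direction \<open>n\<close>; translate it there.\<close>
      define v where "v = axis n (- a $ n)"
      have "?h ` cbox (v + a) (v + b) = (+) (?h v) ` ?h ` cbox a b"
        by (simp add: cbox_translation image_image linear_add[OF lin])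
      moreover have "measure lebesgue (?h ` cbox (v + a) (v + b)) = measure lebesgue (cbox (v + a) (v + b))"
        using that \<open>m \<noteq> n\<close> by (intro measure_shear_interval) (auto simp: cbox_translation v_def)
      moreover have "measure lebesgue (cbox (v + a) (v + b)) = measure lebesgue (cbox a b)"
        by (simp only: cbox_translation measure_translation)
      ultimately show ?thesis by (simp only: measure_translation)
    qed
    with lin det show "Q ?h" by (intro boxes) auto
  qed
  with \<open>S \<in> lmeasurable\<close> show ?thesis by (auto simp: Q_def)
qed

lemma lmeasurable_affine_image:
  fixes f :: "real ^ 'n \<Rightarrow> real ^ 'n"
  assumes "linear f" "S \<in> lmeasurable"
  shows "(\<lambda>x. a + f x) ` S \<in> lmeasurable"
  using measurable_translation[of "f ` S" a] linear_image_scales_measure[OF assms]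
  by (simp add: image_image)

lemma measure_affine_image:
  fixes f :: "real ^ 'n \<Rightarrow> real ^ 'n"
  assumes "linear f" "S \<in> lmeasurable"
  shows "measure lebesgue ((\<lambda>x. a + f x) ` S) = \<bar>det (matrix f)\<bar> * measure lebesgue S"
  using measure_translation[of a "f ` S"] linear_image_scales_measure[OF assms]
  by (simp add: image_image)

text \<open>The square of the determinant is \<open>1\<close>. The reflections and the shear used below are of this form, so that their
  determinants need not be computed.\<close>

lemma measure_affine_involution_image:
  fixes f :: "real ^ 'n \<Rightarrow> real ^ 'n"
  assumes f: "linear f" and inv: "\<And>x. f (f x) = x" and S: "S \<in> lmeasurable"
  shows "measure lebesgue ((\<lambda>x. a + f x) ` S) = measure lebesgue S"
proof -
  have "matrix f ** matrix f = mat 1"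
    using matrix_compose[OF f f] inv by (simp add: o_def matrix_id_mat_1[unfolded id_def])
  then have "det (matrix f) * det (matrix f) = 1"
    by (metis det_I det_mul)
  then have "\<bar>det (matrix f)\<bar> = 1"
    by (metis abs_1 abs_mult_self_eq abs_square_eq_1 power2_eq_square)
  then show ?thesis using measure_affine_image[OF f S] by simp
qed

definition unit_simplex :: "(real ^ 'n) set" where
  "unit_simplex = {x. (\<forall>i. 0 \<le> x $ i) \<and> (\<Sum>i\<in>UNIV. x $ i) \<le> 1}"

lemma unit_simplex_eq_hull: "(unit_simplex :: (real ^ 'n) set) = convex hull (insert 0 Basis)"
proof -
  have "(\<Sum>i\<in>Basis. x \<bullet> i) = (\<Sum>i\<in>UNIV. x $ i)" for x :: "real ^ 'n"
    by (simp add: Basis_vec_def cart_eq_inner_axis axis_eq_axis sum.UNION_disjoint)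
  moreover have "(\<forall>i\<in>Basis. 0 \<le> x \<bullet> i) = (\<forall>i. 0 \<le> x $ i)" for x :: "real ^ 'n"
    by (auto simp: Basis_vec_def cart_eq_inner_axis)
  ultimately show ?thesis
    by (simp add: std_simplex unit_simplex_def)
qed

lemma compact_unit_simplex: "compact (unit_simplex :: (real ^ 'n) set)"
  by (simp add: unit_simplex_eq_hull finite_imp_compact_convex_hull)

lemma lmeasurable_unit_simplex: "(unit_simplex :: (real ^ 'n) set) \<in> lmeasurable"
  by (simp add: compact_unit_simplex lmeasurable_compact)

lemma measure_unit_simplex: "measure lebesgue (unit_simplex :: (real ^ 'n) set) = 1 / fact CARD('n)"
  using content_std_simplex[where 'a = "real ^ 'n"] compact_unit_simplex[where 'n = 'n]
  by (simp add: unit_simplex_eq_hull compact_imp_closed)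

section \<open>Lattice polytopes and cutting by half-spaces\<close>

lemma integer_latticeD: "x \<in> integer_lattice \<Longrightarrow> x $ i \<in> \<int>"
  by (simp add: integer_lattice_def)

definition lattice_cube :: "nat \<Rightarrow> (real ^ 'n) set" where
  "lattice_cube N = {x \<in> integer_lattice. \<forall>i. \<bar>x $ i\<bar> \<le> real N}"

lemma lattice_cube_subset_image:
  "(lattice_cube N :: (real ^ 'n) set) \<subseteq>
     (\<lambda>f. \<chi> i. of_int (f i)) ` (UNIV \<rightarrow>\<^sub>E {- int N..int N})"
proof
  fix x :: "real ^ 'n" assume x: "x \<in> lattice_cube N"
  then have "x = (\<chi> i. of_int \<lfloor>x $ i\<rfloor>)"
    by (auto simp: lattice_cube_def integer_lattice_def vec_eq_iff elim!: Ints_cases)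
  moreover have "\<lfloor>x $ i\<rfloor> \<in> {- int N..int N}" for i
  proof -
    obtain a :: int where a: "x $ i = of_int a"
      using x by (metis (mono_tags, lifting) Ints_cases integer_latticeD lattice_cube_def mem_Collect_eq)
    have "\<bar>real_of_int a\<bar> \<le> real N"
      using x a by (simp add: lattice_cube_def) metis
    with a show ?thesis by simp linarith
  qed
  ultimately show "x \<in> (\<lambda>f. \<chi> i. of_int (f i)) ` (UNIV \<rightarrow>\<^sub>E {- int N..int N})"
    by (intro image_eqI[of _ _ "\<lambda>i. \<lfloor>x $ i\<rfloor>"]) auto
qed

lemma finite_lattice_cube: "finite (lattice_cube N :: (real ^ 'n) set)"
  by (rule finite_subset[OF lattice_cube_subset_image]) (intro finite_imageI finite_PiE, auto)

lemma card_lattice_cube_le: "card (lattice_cube N :: (real ^ 'n) set) \<le> (2 * N + 1) ^ CARD('n)"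
proof -
  have "card (lattice_cube N :: (real ^ 'n) set)
      \<le> card ((\<lambda>f. (\<chi> i. of_int (f i)) :: real ^ 'n) ` (UNIV \<rightarrow>\<^sub>E {- int N..int N}))"
    by (intro card_mono lattice_cube_subset_image finite_imageI finite_PiE) auto
  also have "\<dots> \<le> card ((UNIV :: 'n set) \<rightarrow>\<^sub>E {- int N..int N})"
    by (intro card_image_le finite_PiE) auto
  also have "\<dots> = (2 * N + 1) ^ CARD('n)"
    by (simp add: card_PiE nat_add_distrib nat_mult_distrib)
  finally show ?thesis .
qed

lemma finite_bounded_lattice_points:
  fixes S :: "(real ^ 'n) set"
  assumes "bounded S"
  shows "finite (S \<inter> integer_lattice)"
proof -
  obtain b where b: "\<And>x. x \<in> S \<Longrightarrow> norm x \<le> b"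
    using assms by (auto simp: bounded_iff)
  have "\<bar>x $ i\<bar> \<le> real (nat \<lceil>b\<rceil>)" if "x \<in> S" for x i
    using component_le_norm_cart[of x i] b[OF that] by linarith
  then have "S \<inter> integer_lattice \<subseteq> lattice_cube (nat \<lceil>b\<rceil>)"
    by (auto simp: lattice_cube_def)
  then show ?thesis
    using finite_lattice_cube finite_subset by blast
qed

lemma lattice_polytope_compact_convex:
  assumes "lattice_polytope P"
  shows "compact P" "convex P"
  using assms by (auto simp: lattice_polytope_def polytope_imp_compact polytope_imp_convex)

text \<open>Finiteness of the vertex set is automatic: a bounded set has finitely many lattice points.\<close>

lemma lattice_polytopeI_extreme:
  assumes "compact P" "convex P" and ext: "\<And>x. x extreme_point_of P \<Longrightarrow> x \<in> integer_lattice"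
  shows "lattice_polytope P"
proof -
  have "{x. x extreme_point_of P} \<subseteq> P \<inter> integer_lattice"
    using ext by (auto simp: extreme_point_of_def)
  then have "finite {x. x extreme_point_of P}"
    using finite_bounded_lattice_points[OF compact_imp_bounded[OF \<open>compact P\<close>]] finite_subset by blast
  moreover have "P = convex hull {x. x extreme_point_of P}"
    using assms Krein_Milman_Minkowski by blast
  ultimately show ?thesis
    using ext by (auto simp: lattice_polytope_def polytope_def)
qed

lemma lattice_polytopeI_hull:
  assumes "bounded P" "convex P" "P \<subseteq> convex hull (P \<inter> integer_lattice)"
  shows "lattice_polytope P"
proof -
  have "P = convex hull (P \<inter> integer_lattice)"
    using assms by (intro equalityI hull_minimal) auto
  moreover have "finite (P \<inter> integer_lattice)"
    using assms finite_bounded_lattice_points by blast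
  moreover have "{x. x extreme_point_of P} \<subseteq> integer_lattice"
    using extreme_point_of_convex_hull[of _ "P \<inter> integer_lattice"] calculation(1) by auto
  ultimately show ?thesis
    unfolding lattice_polytope_def polytope_def by blast
qed

lemma convex_combination_in_hull:
  fixes X :: "'i::finite \<Rightarrow> 'a::real_vector"
  assumes "\<And>i. 0 \<le> w i" "(\<Sum>i\<in>UNIV. w i) = 1"
  shows "(\<Sum>i\<in>UNIV. w i *\<^sub>R X i) \<in> convex hull (range X)"
  using assms by (intro convex_sum) (auto intro: hull_inc)

text \<open>The form in which extremality is contradicted below: by a displacement possible in both directions.\<close>

lemma extreme_point_no_symmetric_segment:
  assumes "x extreme_point_of S" "x + v \<in> S" "x - v \<in> S"
  shows "v = 0"
proof (rule ccontr)
  assume "v \<noteq> 0"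
  have "x = (1 - 1/2) *\<^sub>R (x + v) + (1/2) *\<^sub>R (x - v)"
    by (simp add: scaleR_add_right scaleR_diff_right flip: scaleR_add_left)
  moreover have "x + v \<noteq> x - v"
  proof
    assume "x + v = x - v"
    then have "v = - v" by (metis add_left_cancel diff_conv_add_uminus)
    with \<open>v \<noteq> 0\<close> show False by (simp only: eq_neg_iff_add_eq_0) (metis scaleR_2 scaleR_eq_0_iff zero_neq_numeral)
  qed
  ultimately have "x \<in> open_segment (x + v) (x - v)"
    by (auto simp: in_segment intro!: exI[of _ "1/2"])
  then show False using assms by (auto simp: extreme_point_of_def)
qed

text \<open>Affine functions \<open>h\<close> are described by linearity of \<open>\<lambda>x. h x - h 0\<close>, so that the half-spaces \<open>h x \<le> 0\<close> can be
  given by whatever formula is convenient.\<close>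

lemma affine_form_segment:
  fixes h :: "'a::real_vector \<Rightarrow> real"
  assumes "linear (\<lambda>x. h x - h 0)"
  shows "h (x + s *\<^sub>R (y - x)) = h x + s * (h y - h x)"
  using linear_add[OF assms, of x "s *\<^sub>R (y - x)"] linear_scale[OF assms, of s "y - x"]
    linear_diff[OF assms, of y x] by (simp add: algebra_simps)

lemma continuous_on_affine_form:
  fixes h :: "'a::euclidean_space \<Rightarrow> real"
  assumes "linear (\<lambda>x. h x - h 0)"
  shows "continuous_on A h"
proof -
  have "continuous_on A (\<lambda>x. (h x - h 0) + h 0)"
    by (intro continuous_on_add linear_continuous_on continuous_on_const)
      (simp add: assms linear_linear)
  then show ?thesis by simp
qed

lemma closed_affine_form_le:
  fixes h :: "'a::euclidean_space \<Rightarrow> real"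
  assumes "linear (\<lambda>x. h x - h 0)"
  shows "closed {x. h x \<le> 0}"
  using continuous_closed_preimage[OF continuous_on_affine_form[OF assms, of UNIV], of "{..0}"]
  by (simp add: vimage_def)

lemma convex_affine_form_le:
  assumes "linear (\<lambda>x. h x - h 0)"
  shows "convex {x. h x \<le> (0::real)}"
proof (rule convexI)
  fix x y and u v :: real
  assume *: "x \<in> {x. h x \<le> 0}" "y \<in> {x. h x \<le> 0}" "0 \<le> u" "0 \<le> v" "u + v = 1"
  have "u *\<^sub>R x + v *\<^sub>R y = x + v *\<^sub>R (y - x)"
  proof -
    have "u = 1 - v" using \<open>u + v = 1\<close> by simp
    then show ?thesis by (simp add: scaleR_left_diff_distrib scaleR_right_diff_distrib)
  qed
  then have "h (u *\<^sub>R x + v *\<^sub>R y) = u * h x + v * h y"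
  proof -
    have "u = 1 - v" using \<open>u + v = 1\<close> by simp
    then show ?thesis
      using \<open>u *\<^sub>R x + v *\<^sub>R y = x + v *\<^sub>R (y - x)\<close> affine_form_segment[OF assms, of x v y]
      by (simp add: left_diff_distrib right_diff_distrib)
  qed
  also have "\<dots> \<le> 0" using * by (simp add: add_nonpos_nonpos mult_nonneg_nonpos)
  finally show "u *\<^sub>R x + v *\<^sub>R y \<in> {x. h x \<le> 0}" by simp
qed

lemma negligible_affine_form_zero:
  fixes h :: "'a::euclidean_space \<Rightarrow> real"
  assumes lin: "linear (\<lambda>x. h x - h 0)" and "h u \<noteq> h 0"
  shows "negligible {x. h x = 0}"
proof -
  interpret l: linear "\<lambda>x. h x - h 0" by (rule lin)
  define a where "a = (\<Sum>b\<in>Basis. (h b - h 0) *\<^sub>R b)"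
  have "h x - h 0 = a \<bullet> x" for x
  proof -
    have "h x - h 0 = (\<Sum>b\<in>Basis. (x \<bullet> b) * (h b - h 0))"
      using l.sum[of "\<lambda>b. (x \<bullet> b) *\<^sub>R b" Basis] by (simp add: euclidean_representation l.scale)
    also have "\<dots> = a \<bullet> x"
      by (simp add: a_def inner_sum_left) (simp add: inner_commute mult.commute)
    finally show ?thesis .
  qed
  then have a: "h x = a \<bullet> x + h 0" for x
    by (metis diff_add_cancel)
  have "h x = 0 \<longleftrightarrow> a \<bullet> x = - h 0" for x
    using a[of x] by linarith
  then have "{x. h x = 0} = {x. a \<bullet> x = - h 0}" by simp
  moreover have "a \<noteq> 0"
    using \<open>h u \<noteq> h 0\<close> a[of u] by auto
  ultimately show ?thesis by (simp add: negligible_hyperplane)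
qed

text \<open>An extreme point of the cut polytope either lies on the cutting hyperplane, and is then extreme in the new
  face, or it lies strictly inside the half-space, where the cut polytope and \<open>B\<close> agree locally.\<close>

lemma lattice_polytope_cut:
  assumes B: "lattice_polytope B" and lin: "linear (\<lambda>x. h x - h 0)"
    and face: "lattice_polytope {x \<in> B. h x = (0::real)}"
  shows "lattice_polytope {x \<in> B. h x \<le> 0}"
proof (rule lattice_polytopeI_extreme)
  have P: "{x \<in> B. h x \<le> 0} = B \<inter> {x. h x \<le> 0}" by auto
  show "compact {x \<in> B. h x \<le> 0}" "convex {x \<in> B. h x \<le> 0}"
    unfolding P using B lin
    by (simp_all add: compact_Int_closed convex_Int closed_affine_form_le convex_affine_form_le lattice_polytope_compact_convex)
  fix x assume x: "x extreme_point_of {x \<in> B. h x \<le> 0}"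
  then have "x \<in> B" "h x \<le> 0" by (auto simp: extreme_point_of_def)
  show "x \<in> integer_lattice"
  proof (cases "h x = 0")
    case True
    then have "x extreme_point_of {x \<in> B. h x = 0}"
      using x by (auto simp: extreme_point_of_def)
    then show ?thesis using face by (auto simp: lattice_polytope_def)
  next
    case False
    with \<open>h x \<le> 0\<close> have "h x < 0" by simp
    have "x extreme_point_of B"
      unfolding extreme_point_of_def
    proof (intro conjI ballI notI)
      fix u v assume uv: "u \<in> B" "v \<in> B" "x \<in> open_segment u v"
      \<comment> \<open>Shrinking the segment towards \<open>x\<close> keeps it inside the half-space.\<close>
      define e where "e = min 1 (- h x / (1 + \<bar>h u - h x\<bar> + \<bar>h v - h x\<bar>))"
      have e: "0 < e" "e \<le> 1" using \<open>h x < 0\<close> by (auto simp: e_def intro!: divide_neg_pos)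
      have in_cut: "x + e *\<^sub>R (y - x) \<in> {x \<in> B. h x \<le> 0}" if "y = u \<or> y = v" for y
      proof -
        have D: "0 < 1 + \<bar>h u - h x\<bar> + \<bar>h v - h x\<bar>" by simp
        have "e * (h y - h x) \<le> e * (1 + \<bar>h u - h x\<bar> + \<bar>h v - h x\<bar>)"
          using e that by (intro mult_left_mono) auto
        also have "\<dots> \<le> - h x / (1 + \<bar>h u - h x\<bar> + \<bar>h v - h x\<bar>) * (1 + \<bar>h u - h x\<bar> + \<bar>h v - h x\<bar>)"
          by (intro mult_right_mono) (auto simp: e_def)
        also have "\<dots> = - h x" using D by simp
        finally have "h (x + e *\<^sub>R (y - x)) \<le> 0"
          using affine_form_segment[OF lin] by simp
        moreover have "x + e *\<^sub>R (y - x) = (1 - e) *\<^sub>R x + e *\<^sub>R y"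
          by (simp add: algebra_simps)
        then have "x + e *\<^sub>R (y - x) \<in> B"
          using e that uv \<open>x \<in> B\<close> convexD[OF lattice_polytope_compact_convex(2)[OF B], of x y "1 - e" e] by auto
        ultimately show ?thesis by simp
      qed
      obtain s where s: "0 < s" "s < 1" "x = (1 - s) *\<^sub>R u + s *\<^sub>R v" and "u \<noteq> v"
        using uv(3) by (auto simp: in_segment)
      have "x = (1 - s) *\<^sub>R (x + e *\<^sub>R (u - x)) + s *\<^sub>R (x + e *\<^sub>R (v - x))"
      proof -
        have "(1 - s) *\<^sub>R (x + e *\<^sub>R (u - x)) + s *\<^sub>R (x + e *\<^sub>R (v - x))
            = x + e *\<^sub>R (((1 - s) *\<^sub>R u + s *\<^sub>R v) - x)"
          by (simp add: algebra_simps)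
        then show ?thesis using s(3) by simp
      qed
      moreover have "x + e *\<^sub>R (u - x) \<noteq> x + e *\<^sub>R (v - x)" using e \<open>u \<noteq> v\<close> by simp
      ultimately have "x \<in> open_segment (x + e *\<^sub>R (u - x)) (x + e *\<^sub>R (v - x))"
        using s by (auto simp: in_segment)
      then show False using x in_cut[of u] in_cut[of v] by (auto simp: extreme_point_of_def)
    qed fact
    then show ?thesis using B by (auto simp: lattice_polytope_def)
  qed
qed

text \<open>If the closed caps cut off by any one half-space lie in all the others, the cuts do not interact: the new
  faces are those of the individual cuts, and the removed volumes add up.\<close>

lemma lattice_polytope_cuts:
  fixes B :: "(real ^ 'n) set"
  assumes "finite I" and B: "lattice_polytope B"
    and lin: "\<And>i. i \<in> I \<Longrightarrow> linear (\<lambda>x. h i x - h i 0)"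
    and face: "\<And>i. i \<in> I \<Longrightarrow> lattice_polytope {x \<in> B. h i x = (0::real)}"
    and disj: "\<And>i j x. i \<in> I \<Longrightarrow> j \<in> I \<Longrightarrow> i \<noteq> j \<Longrightarrow> x \<in> B \<Longrightarrow> 0 \<le> h i x \<Longrightarrow> h j x \<le> 0"
    and nconst: "\<And>i. i \<in> I \<Longrightarrow> \<exists>u. h i u \<noteq> h i 0"
  shows "lattice_polytope {x \<in> B. \<forall>i\<in>I. h i x \<le> 0} \<and>
    measure lebesgue {x \<in> B. \<forall>i\<in>I. h i x \<le> 0}
      = measure lebesgue B - (\<Sum>i\<in>I. measure lebesgue {x \<in> B. 0 \<le> h i x})"
  using assms(1) lin face disj nconst
proof (induction I rule: finite_induct)
  case empty
  then show ?case using B by simp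
next
  case (insert j I)
  let ?P = "{x \<in> B. \<forall>i\<in>I. h i x \<le> 0}"
  let ?Q = "{x \<in> B. \<forall>i\<in>insert j I. h i x \<le> 0}"
  have IH: "lattice_polytope ?P"
    "measure lebesgue ?P = measure lebesgue B - (\<Sum>i\<in>I. measure lebesgue {x \<in> B. 0 \<le> h i x})"
  proof -
    have "h j x \<le> 0" if "i \<in> I" "j \<in> I" "i \<noteq> j" "x \<in> B" "0 \<le> h i x" for i j x
      using insert.prems(3)[of i j x] that by simp
    from insert.IH[OF _ _ this] insert.prems(1,2,4)
    show "lattice_polytope ?P"
      "measure lebesgue ?P = measure lebesgue B - (\<Sum>i\<in>I. measure lebesgue {x \<in> B. 0 \<le> h i x})"
      by simp_all
  qed
  have keep: "h i x \<le> 0" if "i \<in> I" "x \<in> B" "0 \<le> h j x" for i x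
    using insert.hyps insert.prems(3)[of j i x] that by auto
  have lin: "linear (\<lambda>x. h j x - h j 0)" using insert.prems by simp
  have Q: "?Q = {x \<in> ?P. h j x \<le> 0}" by auto
  have face: "{x \<in> ?P. h j x = 0} = {x \<in> B. h j x = 0}" using keep by auto
  have lat: "lattice_polytope ?Q"
    unfolding Q
    by (rule lattice_polytope_cut[OF IH(1) lin]) (use insert.prems(2)[of j] in \<open>simp only: face insertI1\<close>)
  have cap: "{x \<in> B. 0 \<le> h j x} = B \<inter> {x. - h j x \<le> 0}" by auto
  have "linear (\<lambda>x. - h j x - - h j 0)"
    using linear_compose_neg[OF lin] by (simp add: algebra_simps)
  from closed_affine_form_le[OF this] have "compact {x \<in> B. 0 \<le> h j x}"
    unfolding cap by (rule compact_Int_closed[OF lattice_polytope_compact_convex(1)[OF B]])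
  then have meas: "{x \<in> B. 0 \<le> h j x} \<in> lmeasurable" "?Q \<in> lmeasurable"
    using lat lattice_polytope_compact_convex lmeasurable_compact by blast+
  have "?P = ?Q \<union> {x \<in> B. 0 \<le> h j x}" using keep by auto
  moreover have "negligible (?Q \<inter> {x \<in> B. 0 \<le> h j x})"
  proof -
    obtain u where "h j u \<noteq> h j 0" using insert.prems(4)[of j] by auto
    from negligible_affine_form_zero[OF lin this] show ?thesis
      by (rule negligible_subset) auto
  qed
  ultimately have "measure lebesgue ?P = measure lebesgue ?Q + measure lebesgue {x \<in> B. 0 \<le> h j x}"
    using meas by (simp add: measure_Un3 negligible_imp_measure0)
  then show ?case using lat IH(2) insert.hyps by simp
qed

section \<open>The region above the chord interpolation of the paraboloid\<close>

text \<open>The piecewise linear interpolation of \<open>t\<^sup>2\<close> at the integers.\<close>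

definition chord_square :: "real \<Rightarrow> real" where
  "chord_square t = (2 * of_int \<lfloor>t\<rfloor> + 1) * t - of_int \<lfloor>t\<rfloor> ^ 2 - of_int \<lfloor>t\<rfloor>"

lemma chord_square_ge_chord:
  "(2 * of_int a + 1) * t - of_int a ^ 2 - of_int a \<le> chord_square t"
proof -
  define n where "n = \<lfloor>t\<rfloor>"
  have n: "of_int n \<le> t" "t < of_int n + 1" by (simp_all add: n_def)
  have "0 \<le> (of_int n - of_int a) * (2 * t - (of_int n + of_int a + 1))"
  proof (cases n a rule: linorder_cases)
    case less
    then have "real_of_int n + 1 \<le> of_int a" by linarith
    then show ?thesis using n by (intro mult_nonpos_nonpos) auto
  next
    case greater
    then have "real_of_int a + 1 \<le> of_int n" by linarith
    then show ?thesis using n by (intro mult_nonneg_nonneg) auto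
  qed simp
  also have "\<dots> = chord_square t - ((2 * of_int a + 1) * t - of_int a ^ 2 - of_int a)"
    by (simp add: chord_square_def n_def algebra_simps power2_eq_square)
  finally show ?thesis by simp
qed

lemma chord_square_eq_chord:
  assumes "of_int a \<le> t" "t \<le> of_int a + 1"
  shows "chord_square t = (2 * of_int a + 1) * t - of_int a ^ 2 - of_int a"
proof (cases "t = of_int a + 1")
  case True
  then have "\<lfloor>t\<rfloor> = a + 1" by simp
  then show ?thesis by (simp add: chord_square_def True algebra_simps power2_eq_square)
next
  case False
  with assms have "\<lfloor>t\<rfloor> = a" by (intro floor_unique) auto
  then show ?thesis by (simp add: chord_square_def)
qed

text \<open>The chords of the square function on both sides of the integer \<open>a\<close> leave its tangent at \<open>a\<close> with slopes \<open>1\<close> and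
  \<open>-1\<close>; elsewhere convexity gives more. Thus the epigraph near \<open>a\<close> is a cone over the tangent.\<close>

lemma chord_square_ge_abs:
  "\<bar>t - of_int a\<bar> + 2 * of_int a * t - of_int a ^ 2 \<le> chord_square t"
  using chord_square_ge_chord[of a t] chord_square_ge_chord[of "a - 1" t]
  by (cases "t \<ge> of_int a") (simp_all add: algebra_simps power2_eq_square)

lemma chord_square_eq_abs:
  assumes "\<bar>t - of_int a\<bar> \<le> 1"
  shows "chord_square t = \<bar>t - of_int a\<bar> + 2 * of_int a * t - of_int a ^ 2"
proof (cases "t \<ge> of_int a")
  case True
  with assms show ?thesis
    using chord_square_eq_chord[of a t] by (simp add: algebra_simps power2_eq_square)
next
  case False
  with assms show ?thesis
    using chord_square_eq_chord[of "a - 1" t] by (simp add: algebra_simps power2_eq_square)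
qed

lemma chord_square_bounds: "t\<^sup>2 \<le> chord_square t" "chord_square t \<le> t\<^sup>2 + 1"
proof -
  define n where "n = \<lfloor>t\<rfloor>"
  have n: "of_int n \<le> t" "t < of_int n + 1" by (simp_all add: n_def)
  have eq: "chord_square t - t\<^sup>2 = (t - of_int n) * (of_int n + 1 - t)"
    by (simp add: chord_square_def n_def algebra_simps power2_eq_square)
  have "0 \<le> (t - of_int n) * (of_int n + 1 - t)" "(t - of_int n) * (of_int n + 1 - t) \<le> 1 * 1"
    using n by (intro mult_nonneg_nonneg mult_mono; linarith)+
  with eq show "t\<^sup>2 \<le> chord_square t" "chord_square t \<le> t\<^sup>2 + 1" by linarith+
qed

lemma chord_square_Ints: "t \<in> \<int> \<Longrightarrow> chord_square t \<in> \<int>"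
  by (auto simp: chord_square_def)

definition chord_region :: "'n::finite \<Rightarrow> nat \<Rightarrow> real \<Rightarrow> (real ^ 'n) set" where
  "chord_region k L H = {p. (\<forall>i\<in>-{k}. 0 \<le> p $ i \<and> p $ i \<le> real L)
     \<and> (\<Sum>i\<in>-{k}. chord_square (p $ i)) \<le> p $ k \<and> p $ k \<le> H}"

text \<open>The affine function whose graph carries the facet over the unit cube with lowest corner \<open>z\<close>; the
  interpolation is the supremum of these functions, so the region above it is convex.\<close>

definition chord_form :: "'n::finite \<Rightarrow> ('n \<Rightarrow> int) \<Rightarrow> real ^ 'n \<Rightarrow> real" where
  "chord_form k z p = (\<Sum>i\<in>-{k}. (2 * of_int (z i) + 1) * p $ i - of_int (z i) ^ 2 - of_int (z i))"

lemma sum_chord_square_le_iff: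
  "(\<Sum>i\<in>-{k}. chord_square (p $ i)) \<le> y \<longleftrightarrow> (\<forall>z. chord_form k z p \<le> y)"
proof
  assume "(\<Sum>i\<in>-{k}. chord_square (p $ i)) \<le> y"
  moreover have "chord_form k z p \<le> (\<Sum>i\<in>-{k}. chord_square (p $ i))" for z
    unfolding chord_form_def by (intro sum_mono chord_square_ge_chord)
  ultimately show "\<forall>z. chord_form k z p \<le> y" by (meson order_trans)
next
  assume "\<forall>z. chord_form k z p \<le> y"
  then have "chord_form k (\<lambda>i. \<lfloor>p $ i\<rfloor>) p \<le> y" by blast
  then show "(\<Sum>i\<in>-{k}. chord_square (p $ i)) \<le> y"
    by (simp add: chord_form_def chord_square_def)
qed

lemma linear_chord_form: "linear (\<lambda>p. chord_form k z p - chord_form k z 0)"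
proof -
  have "chord_form k z p - chord_form k z 0 = (\<Sum>i\<in>-{k}. (2 * of_int (z i) + 1) * p $ i)" for p
    by (simp add: chord_form_def flip: sum_subtractf)
  then show ?thesis
    unfolding linear_iff by (simp only:) (simp add: sum.distrib sum_distrib_left algebra_simps)
qed

lemma linear_chord_form_minus_height:
  "linear (\<lambda>p. chord_form k z p - p $ k - (chord_form k z 0 - 0 $ k))"
  using linear_compose_sub[OF linear_chord_form[of k z], of "\<lambda>p. p $ k"]
  by (simp add: algebra_simps linear_iff)

text \<open>Used with \<open>c\<close> the centre of a cube, to halve a box.\<close>

lemma chord_form_reflect: "chord_form k z (2 *\<^sub>R c - p) = 2 * chord_form k z c - chord_form k z p"
  by (simp add: chord_form_def sum_distrib_left algebra_simps flip: sum_subtractf sum.distrib)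

lemma compact_convex_chord_region: "compact (chord_region k L H)" "convex (chord_region k L H)"
proof -
  have eq: "chord_region k L H = cbox (\<chi> i. if i = k then 0 else 0) (\<chi> i. if i = k then H else real L)
      \<inter> (\<Inter>z. {p. chord_form k z p - p $ k \<le> 0})"
  proof -
    have "0 \<le> p $ k" if "(\<Sum>i\<in>-{k}. chord_square (p $ i)) \<le> p $ k" for p
    proof -
      have "0 \<le> chord_square (p $ i)" for i using chord_square_bounds(1)[of "p $ i"] by (meson order_trans zero_le_power2)
      then have "0 \<le> (\<Sum>i\<in>-{k}. chord_square (p $ i))" by (rule sum_nonneg)
      with that show ?thesis by linarith
    qed
    moreover have "p \<in> cbox (\<chi> i. if i = k then 0 else 0) (\<chi> i. if i = k then H else real L)
        \<longleftrightarrow> (\<forall>i\<in>-{k}. 0 \<le> p $ i \<and> p $ i \<le> real L) \<and> 0 \<le> p $ k \<and> p $ k \<le> H" for p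
      by (auto simp: mem_box_cart)
    moreover have "p \<in> (\<Inter>z. {p. chord_form k z p - p $ k \<le> 0}) \<longleftrightarrow> (\<Sum>i\<in>-{k}. chord_square (p $ i)) \<le> p $ k" for p
      unfolding sum_chord_square_le_iff by simp
    ultimately show ?thesis
      unfolding chord_region_def set_eq_iff Int_iff mem_Collect_eq by meson
  qed
  show "compact (chord_region k L H)" "convex (chord_region k L H)"
    unfolding eq
    by (intro compact_Int_closed compact_cbox closed_INT ballI closed_affine_form_le linear_chord_form_minus_height
        convex_Int convex_box convex_INT convex_affine_form_le)+
qed

text \<open>An integer above all values, increased by \<open>1\<close>, of the interpolation over the cube of side \<open>L\<close>.\<close>

definition chord_height :: "'n::finite itself \<Rightarrow> nat \<Rightarrow> nat" where
  "chord_height _ L = CARD('n) * (L\<^sup>2 + 1)"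

lemma sum_chord_square_le_height:
  fixes p :: "real ^ 'n"
  assumes "\<forall>i\<in>-{k}. 0 \<le> p $ i \<and> p $ i \<le> real L"
  shows "(\<Sum>i\<in>-{k}. chord_square (p $ i)) + 1 \<le> real (chord_height TYPE('n) L)"
proof -
  have "(\<Sum>i\<in>-{k}. chord_square (p $ i)) \<le> (\<Sum>i\<in>-{k}. real L ^ 2 + 1)"
  proof (rule sum_mono)
    fix i assume "i \<in> -{k}"
    then have "(p $ i)\<^sup>2 \<le> (real L)\<^sup>2" using assms by (intro power_mono) auto
    then show "chord_square (p $ i) \<le> real L ^ 2 + 1" using chord_square_bounds(2)[of "p $ i"] by linarith
  qed
  also have "\<dots> = (real CARD('n) - 1) * (real L ^ 2 + 1)"
    by (simp add: card_Diff_singleton Compl_eq_Diff_UNIV of_nat_diff)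
  finally show ?thesis
    by (simp add: chord_height_def algebra_simps) (smt (verit) zero_le_power2)
qed

text \<open>At an extreme point the height is that of the chord graph or the top \<open>H\<close>, for otherwise the point moves
  vertically. A non-integral coordinate \<open>i \<noteq> k\<close> could be varied in both directions inside its unit interval,
  where the interpolation is linear.\<close>

lemma lattice_polytope_chord_region:
  fixes k :: "'n::finite"
  assumes H: "H \<in> \<int>" "real (chord_height TYPE('n) L) \<le> H"
  shows "lattice_polytope (chord_region k L H :: (real ^ 'n) set)"
proof (rule lattice_polytopeI_extreme[OF compact_convex_chord_region])
  fix p :: "real ^ 'n" assume ext: "p extreme_point_of (chord_region k L H)"
  let ?f = "\<lambda>p::real ^ 'n. \<Sum>i\<in>-{k}. chord_square (p $ i)"
  have p: "p \<in> chord_region k L H" using ext by (simp add: extreme_point_of_def)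
  then have box: "\<forall>i\<in>-{k}. 0 \<le> p $ i \<and> p $ i \<le> real L" and fp: "?f p \<le> p $ k" "p $ k \<le> H"
    by (auto simp: chord_region_def)
  have flat: "p $ k = ?f p \<or> p $ k = H"
  proof (rule ccontr)
    assume "\<not> ?thesis"
    then have lt: "?f p < p $ k" "p $ k < H" using fp by auto
    define e where "e = min (p $ k - ?f p) (H - p $ k)"
    have e: "e > 0" "e \<le> p $ k - ?f p" "e \<le> H - p $ k" using lt by (auto simp: e_def)
    have "p + axis k e \<in> chord_region k L H" "p - axis k e \<in> chord_region k L H"
      using box lt e by (auto simp: chord_region_def axis_def)
    from extreme_point_no_symmetric_segment[OF ext this] e show False
      by (simp add: axis_eq_0_iff)
  qed
  have int: "p $ i \<in> \<int>" if i: "i \<in> -{k}" for i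
  proof (rule ccontr)
    assume nint: "p $ i \<notin> \<int>"
    define z where "z = \<lfloor>p $ i\<rfloor>"
    have z: "of_int z < p $ i" "p $ i < of_int z + 1"
    proof -
      have "real_of_int z \<noteq> p $ i" using nint by (metis Ints_of_int)
      then show "of_int z < p $ i" "p $ i < of_int z + 1" unfolding z_def by linarith+
    qed
    define e where "e = min (p $ i - of_int z) (of_int z + 1 - p $ i)"
    have e: "e > 0" "e \<le> p $ i - of_int z" "e \<le> of_int z + 1 - p $ i" using z by (auto simp: e_def)
    have "0 \<le> real_of_int z" "real_of_int z + 1 \<le> real L"
    proof -
      have "0 \<le> p $ i" "p $ i \<le> real L" using box i by auto
      with z have "-1 < real_of_int z" "real_of_int z < real_of_int (int L)" by auto
      then have "0 \<le> z" "z < int L" by linarith+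
      then show "0 \<le> real_of_int z" "real_of_int z + 1 \<le> real L" by linarith+
    qed
    note zL = this
    \<comment> \<open>A point on the chord graph moves along the chord, a point strictly above it horizontally.\<close>
    define s :: real where "s = (if p $ k = ?f p then 2 * of_int z + 1 else 0)"
    define v :: "real ^ 'n" where "v = (\<chi> j. if j = i then e else if j = k then s * e else 0)"
    have step: "p + c *\<^sub>R v \<in> chord_region k L H" if c: "c = 1 \<or> c = -1" for c
    proof -
      have v: "(p + c *\<^sub>R v) $ j = (if j = i then p $ i + c * e else p $ j)" if "j \<noteq> k" for j
        using that by (simp add: v_def)
      have vk: "(p + c *\<^sub>R v) $ k = p $ k + c * s * e"
        using i by (simp add: v_def)
      have "chord_square (p $ i + c * e) - chord_square (p $ i) = (2 * of_int z + 1) * (c * e)"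
        using c e by (subst (1 2) chord_square_eq_chord[of z]) (auto simp: algebra_simps)
      then have f: "?f (p + c *\<^sub>R v) = ?f p + (2 * of_int z + 1) * (c * e)"
      proof -
        have "(\<Sum>j\<in>-{k} - {i}. chord_square ((p + c *\<^sub>R v) $ j)) = (\<Sum>j\<in>-{k} - {i}. chord_square (p $ j))"
          by (rule sum.cong) (auto simp: v_def)
        then show ?thesis
          using i \<open>chord_square (p $ i + c * e) - _ = _\<close>
          by (simp add: sum.remove[of "-{k}" i] v_def)
      qed
      have box': "\<forall>j\<in>-{k}. 0 \<le> (p + c *\<^sub>R v) $ j \<and> (p + c *\<^sub>R v) $ j \<le> real L"
        using box e zL c by (auto simp: v_def)
      have "?f (p + c *\<^sub>R v) \<le> H"
        using sum_chord_square_le_height[OF box'] H by linarith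
      then show ?thesis
        using box' f vk flat fp by (auto simp: chord_region_def s_def algebra_simps)
    qed
    have "v = 0"
      using extreme_point_no_symmetric_segment[OF ext, of v] step[of 1] step[of "-1"] by simp
    then have "v $ i = 0" by simp
    with e show False by (simp add: v_def)
  qed
  moreover have "?f p \<in> \<int>"
    using int chord_square_Ints by (intro Ints_sum) auto
  with flat H have "p $ k \<in> \<int>" by auto
  ultimately have "p $ i \<in> \<int>" for i
    using int by (cases "i = k") auto
  then show "p \<in> integer_lattice"
    by (simp add: integer_lattice_def)
qed

definition chord_cell :: "'n::finite \<Rightarrow> real \<Rightarrow> ('n \<Rightarrow> int) \<Rightarrow> (real ^ 'n) set" where
  "chord_cell k H z = {p. (\<forall>i\<in>-{k}. of_int (z i) \<le> p $ i \<and> p $ i \<le> of_int (z i) + 1)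
     \<and> chord_form k z p \<le> p $ k \<and> p $ k \<le> H}"

text \<open>The point reflection in the centre of the facet over the cube maps the part of a box above the facet to the part
  below it, so each part is half of the box. The height of the centre is the sum on the right.\<close>

lemma measure_chord_cell:
  fixes k :: "'n::finite"
  assumes below: "\<And>p. \<forall>i\<in>-{k}. of_int (z i) \<le> p $ i \<and> p $ i \<le> of_int (z i) + 1 \<Longrightarrow> chord_form k z p \<le> H"
  shows "chord_cell k H z \<in> lmeasurable"
    "measure lebesgue (chord_cell k H z) = H - (\<Sum>i\<in>-{k}. of_int (z i) ^ 2 + of_int (z i) + 1/2)"
proof -
  let ?A = "chord_cell k H z"
  let ?inbox = "\<lambda>p::real ^ 'n. \<forall>i\<in>-{k}. of_int (z i) \<le> p $ i \<and> p $ i \<le> of_int (z i) + 1"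
  define m :: real where "m = (\<Sum>i\<in>-{k}. of_int (z i) ^ 2 + of_int (z i) + 1/2)"
  define c :: "real ^ 'n" where "c = (\<chi> i. if i = k then m else of_int (z i) + 1/2)"
  have "chord_form k z c = m"
    unfolding chord_form_def m_def by (intro sum.cong) (auto simp: c_def algebra_simps power2_eq_square)
  then have refl: "chord_form k z (2 *\<^sub>R c - p) = 2 * m - chord_form k z p" for p
    by (simp add: chord_form_reflect)
  have refl_box: "?inbox (2 *\<^sub>R c - p) \<longleftrightarrow> ?inbox p" for p
    by (rule ball_cong) (auto simp: c_def)
  define Q where "Q = cbox (\<chi> i. if i = k then 2 * m - H else of_int (z i)) (\<chi> i. if i = k then H else of_int (z i) + 1)"
  have Q: "p \<in> Q \<longleftrightarrow> ?inbox p \<and> 2 * m - H \<le> p $ k \<and> p $ k \<le> H" for p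
    by (auto simp: Q_def mem_box_cart)
  have lower: "2 * m - H \<le> chord_form k z p" if "?inbox p" for p
    using below[of "2 *\<^sub>R c - p"] that unfolding refl_box refl by linarith
  have A: "?A = Q \<inter> {p. chord_form k z p - p $ k \<le> 0}"
    using lower by (force simp: chord_cell_def Q)
  have "compact ?A"
    unfolding A Q_def
    by (intro compact_Int_closed compact_cbox closed_affine_form_le linear_chord_form_minus_height)
  then show meas: "?A \<in> lmeasurable" by (rule lmeasurable_compact)
  define R where "R = (\<lambda>p. 2 *\<^sub>R c + - p) ` ?A"
  have R: "p \<in> R \<longleftrightarrow> 2 *\<^sub>R c - p \<in> ?A" for p
    by (auto simp: R_def intro!: image_eqI[of _ _ "2 *\<^sub>R c - p"])
  have measR: "R \<in> lmeasurable" "measure lebesgue R = measure lebesgue ?A"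
    using meas unfolding R_def by (intro lmeasurable_affine_image measure_affine_involution_image; simp add: linear_iff)+
  have R': "p \<in> R \<longleftrightarrow> ?inbox p \<and> p $ k \<le> chord_form k z p \<and> 2 * m - H \<le> p $ k" for p
  proof -
    have "(2 *\<^sub>R c - p) $ k = 2 * m - p $ k" by (simp add: c_def)
    then have "2 *\<^sub>R c - p \<in> ?A \<longleftrightarrow> ?inbox p \<and> p $ k \<le> chord_form k z p \<and> 2 * m - H \<le> p $ k"
      unfolding chord_cell_def mem_Collect_eq refl_box refl by auto
    then show ?thesis unfolding R .
  qed
  have "Q = ?A \<union> R"
  proof -
    have "p \<in> Q \<longleftrightarrow> p \<in> ?A \<or> p \<in> R" for p
    proof (cases "?inbox p")
      case True
      then show ?thesis
        using below[OF True] lower[OF True] by (auto simp only: R' Q chord_cell_def mem_Collect_eq)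
    next
      case False
      then show ?thesis by (auto simp only: R' Q chord_cell_def mem_Collect_eq)
    qed
    then show ?thesis by blast
  qed
  moreover have "negligible (?A \<inter> R)"
  proof (rule negligible_subset)
    show "negligible {p. chord_form k z p - p $ k = 0}"
      by (rule negligible_affine_form_zero[OF linear_chord_form_minus_height, of _ _ "axis k 1"])
        (simp add: chord_form_def axis_def)
    show "?A \<inter> R \<subseteq> {p. chord_form k z p - p $ k = 0}"
      unfolding subset_iff Int_iff R' A by auto
  qed
  ultimately have "measure lebesgue Q = 2 * measure lebesgue ?A"
    using meas measR by (simp add: measure_Un3 negligible_imp_measure0)
  moreover have "measure lebesgue Q = 2 * (H - m)"
  proof -
    have "chord_form k z c \<le> H" by (rule below) (auto simp: c_def)
    then have "m \<le> H" using \<open>chord_form k z c = m\<close> by simp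
    then have "c \<in> Q" unfolding Q by (auto simp: c_def)
    then have "measure lebesgue Q = (\<Prod>i\<in>UNIV. (\<chi> i. if i = k then H else of_int (z i) + 1) $ i
        - (\<chi> i. if i = k then 2 * m - H else of_int (z i)) $ i)"
      unfolding Q_def by (subst content_cbox_cart[symmetric]) auto
    also have "\<dots> = (\<Prod>i\<in>UNIV. if i = k then 2 * (H - m) else 1)"
      by (intro prod.cong) auto
    finally have "measure lebesgue Q = (\<Prod>i\<in>UNIV. if i = k then 2 * (H - m) else 1)" .
    then show ?thesis by simp
  qed
  ultimately show "measure lebesgue ?A = H - (\<Sum>i\<in>-{k}. of_int (z i) ^ 2 + of_int (z i) + 1/2)"
    by (simp add: m_def)
qed

lemma chord_region_eq_cells:
  fixes k :: "'n::finite"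
  assumes L: "1 \<le> L"
  shows "chord_region k L H = (\<Union>z \<in> (-{k}) \<rightarrow>\<^sub>E {0..<int L}. chord_cell k H z)"
proof (intro equalityI subsetI)
  fix p assume "p \<in> chord_region k L H"
  then have box: "\<forall>i\<in>-{k}. 0 \<le> p $ i \<and> p $ i \<le> real L" and h: "(\<Sum>i\<in>-{k}. chord_square (p $ i)) \<le> p $ k" "p $ k \<le> H"
    by (auto simp: chord_region_def)
  show "p \<in> (\<Union>z \<in> (-{k}) \<rightarrow>\<^sub>E {0..<int L}. chord_cell k H z)"
  proof -
    define z where "z = restrict (\<lambda>i. min \<lfloor>p $ i\<rfloor> (int L - 1)) (-{k})"
    have z: "of_int (z i) \<le> p $ i \<and> p $ i \<le> of_int (z i) + 1" if "i \<in> -{k}" for i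
      using box that by (auto simp: z_def min_def) linarith+
    have "z i \<in> {0..<int L}" if "i \<in> -{k}" for i
      using box that L by (auto simp: z_def min_def)
    then have "z \<in> (-{k}) \<rightarrow>\<^sub>E {0..<int L}" by (auto simp: z_def PiE_iff)
    moreover have "chord_form k z p = (\<Sum>i\<in>-{k}. chord_square (p $ i))"
      unfolding chord_form_def using z by (intro sum.cong refl chord_square_eq_chord[symmetric]) auto
    ultimately show ?thesis using h z by (intro UN_I[of z]) (auto simp: chord_cell_def)
  qed
next
  fix p assume "p \<in> (\<Union>z \<in> (-{k}) \<rightarrow>\<^sub>E {0..<int L}. chord_cell k H z)"
  then obtain z where z: "z \<in> (-{k}) \<rightarrow>\<^sub>E {0..<int L}" and p: "p \<in> chord_cell k H z" by blast
  have "(\<Sum>i\<in>-{k}. chord_square (p $ i)) = chord_form k z p"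
    unfolding chord_form_def using p by (intro sum.cong refl chord_square_eq_chord) (auto simp: chord_cell_def)
  moreover have "0 \<le> p $ i \<and> p $ i \<le> real L" if "i \<in> -{k}" for i
  proof -
    have "z i \<in> {0..<int L}" using z that by (rule PiE_mem)
    then have "0 \<le> z i" "z i + 1 \<le> int L" by auto
    then have "0 \<le> real_of_int (z i)" "real_of_int (z i) + 1 \<le> real L" by linarith+
    moreover have "of_int (z i) \<le> p $ i \<and> p $ i \<le> of_int (z i) + 1" using p that by (auto simp: chord_cell_def)
    ultimately show ?thesis by linarith
  qed
  ultimately show "p \<in> chord_region k L H" using p by (auto simp: chord_region_def chord_cell_def)
qed

text \<open>Here \<open>w\<close> is \<open>d!\<close> times the volume under the interpolation. It is an integer because the volumes over the unit cubes
  are half-integers and \<open>d!\<close> is even; its upper bound says that the volume is nonnegative for the smallest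
  \<open>H\<close>.\<close>

lemma chord_region_volume:
  fixes k :: "'n::finite"
  assumes d: "2 \<le> CARD('n)" and L: "1 \<le> L"
  obtains w :: int where "0 \<le> w" "w \<le> fact CARD('n) * int L ^ (CARD('n) - 1) * int (chord_height TYPE('n) L)"
    "\<And>H. real (chord_height TYPE('n) L) \<le> H \<Longrightarrow>
      fact CARD('n) * measure lebesgue (chord_region k L H :: (real ^ 'n) set)
        = fact CARD('n) * real L ^ (CARD('n) - 1) * H - of_int w"
proof -
  let ?Z = "(-{k}) \<rightarrow>\<^sub>E {0..<int L}"
  define s :: "('n \<Rightarrow> int) \<Rightarrow> int" where "s z = (\<Sum>i\<in>-{k}. 2 * z i ^ 2 + 2 * z i + 1)" for z
  define w :: int where "w = fact CARD('n) div 2 * (\<Sum>z\<in>?Z. s z)"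
  have fin: "finite ?Z" by (simp add: finite_PiE)
  have cardZ: "card ?Z = L ^ (CARD('n) - 1)"
    by (simp add: card_PiE Compl_eq_Diff_UNIV card_Diff_singleton)
  have even: "even (fact CARD('n) :: int)" 
  proof -
    have "2 dvd (fact CARD('n) :: nat)" using d by (intro dvd_fact) auto
    then have "int 2 dvd int (fact CARD('n))" by (simp only: int_dvd_int_iff)
    then show ?thesis by (simp only: of_nat_fact of_nat_numeral)
  qed
  have vol: "fact CARD('n) * measure lebesgue (chord_region k L H :: (real ^ 'n) set)
        = fact CARD('n) * real L ^ (CARD('n) - 1) * H - of_int w"
    if H: "real (chord_height TYPE('n) L) \<le> H" for H
  proof -
    have cell: "chord_cell k H z \<in> lmeasurable"
      "measure lebesgue (chord_cell k H z) = H - of_int (s z) / 2" if z: "z \<in> ?Z" for z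
    proof -
      have below: "chord_form k z p \<le> H"
        if p: "\<forall>i\<in>-{k}. of_int (z i) \<le> p $ i \<and> p $ i \<le> of_int (z i) + 1" for p
      proof -
        have "0 \<le> p $ i \<and> p $ i \<le> real L" if "i \<in> -{k}" for i
        proof -
          have "z i \<in> {0..<int L}" using z that by (rule PiE_mem)
          then have "0 \<le> z i" "z i + 1 \<le> int L" by auto
          then have "0 \<le> real_of_int (z i)" "real_of_int (z i) + 1 \<le> real L" by linarith+
          then show ?thesis using bspec[OF p that] by linarith
        qed
        then have "(\<Sum>i\<in>-{k}. chord_square (p $ i)) \<le> H"
          using sum_chord_square_le_height[of k p L] H by auto
        then show ?thesis unfolding sum_chord_square_le_iff by blast
      qed
      have "(\<Sum>i\<in>-{k}. of_int (z i) ^ 2 + of_int (z i) + 1/2) = real_of_int (s z) / 2"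
        unfolding s_def of_int_sum sum_divide_distrib by (intro sum.cong) auto
      then show "chord_cell k H z \<in> lmeasurable"
        "measure lebesgue (chord_cell k H z) = H - of_int (s z) / 2"
        using measure_chord_cell[OF below] by simp_all
    qed
    have overlap: "negligible (chord_cell k H z \<inter> chord_cell k H z')"
      if zz: "z \<in> ?Z" "z' \<in> ?Z" "z \<noteq> z'" for z z'
    proof -
      obtain i where i: "i \<in> -{k}" "z i \<noteq> z' i"
        using PiE_ext[OF zz(1,2)] zz(3) by auto
      show ?thesis
      proof (rule negligible_subset)
        show "negligible {p::real ^ 'n. p $ i - of_int (max (z i) (z' i)) = 0}"
          by (rule negligible_affine_form_zero[of _ "axis i 1"]) (simp_all add: linear_iff algebra_simps)
        show "chord_cell k H z \<inter> chord_cell k H z' \<subseteq> {p. p $ i - of_int (max (z i) (z' i)) = 0}"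
        proof clarify
          fix p assume "p \<in> chord_cell k H z" "p \<in> chord_cell k H z'"
          then have "of_int (z i) \<le> p $ i" "p $ i \<le> of_int (z i) + 1"
              "of_int (z' i) \<le> p $ i" "p $ i \<le> of_int (z' i) + 1"
            using i by (auto simp: chord_cell_def)
          moreover have "real_of_int (z i) + 1 \<le> of_int (z' i) \<or> real_of_int (z' i) + 1 \<le> of_int (z i)"
            using i(2) by linarith
          ultimately show "p $ i - of_int (max (z i) (z' i)) = 0"
            by (auto simp: max_def)
        qed
      qed
    qed
    have "measure lebesgue (chord_region k L H :: (real ^ 'n) set)
        = (\<Sum>z\<in>?Z. measure lebesgue (chord_cell k H z :: (real ^ 'n) set))"
      unfolding chord_region_eq_cells[OF L]
      using fin cell(1) overlap by (intro measure_negligible_finite_Union_image) (auto simp: pairwise_def)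
    also have "\<dots> = real L ^ (CARD('n) - 1) * H - of_int (\<Sum>z\<in>?Z. s z) / 2"
      using cell(2) by (simp add: sum_subtractf cardZ sum_divide_distrib)
    finally have "fact CARD('n) * measure lebesgue (chord_region k L H :: (real ^ 'n) set)
        = fact CARD('n) * real L ^ (CARD('n) - 1) * H - fact CARD('n) / 2 * of_int (\<Sum>z\<in>?Z. s z)"
      by (simp add: right_diff_distrib)
    moreover have "real_of_int (fact CARD('n) div 2) = fact CARD('n) / 2"
      using even real_of_int_div[of 2 "fact CARD('n)"] by simp
    ultimately show ?thesis by (simp add: w_def)
  qed
  show thesis
  proof (rule that[of w])
    have "0 \<le> s z" if "z \<in> ?Z" for z
    proof -
      have "0 \<le> z i" if "i \<in> -{k}" for i using \<open>z \<in> ?Z\<close> that by (auto simp: PiE_iff)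
      then show ?thesis unfolding s_def by (intro sum_nonneg) auto
    qed
    then show "0 \<le> w" unfolding w_def by (intro mult_nonneg_nonneg sum_nonneg) auto
    have "0 \<le> fact CARD('n) * measure lebesgue (chord_region k L (real (chord_height TYPE('n) L)) :: (real ^ 'n) set)"
      by simp
    then have "real_of_int w \<le> real_of_int (fact CARD('n) * int L ^ (CARD('n) - 1) * int (chord_height TYPE('n) L))"
      unfolding vol[OF order_refl] by simp
    then show "w \<le> fact CARD('n) * int L ^ (CARD('n) - 1) * int (chord_height TYPE('n) L)"
      by (simp only: of_int_le_iff)
  qed (rule vol)
qed

section \<open>Cutting off lattice points of the paraboloid\<close>

text \<open>The shape of the piece removed with a lattice point: a pyramid of height \<open>1\<close> over a cross-polytope.\<close>

definition half_cross_polytope :: "'n::finite \<Rightarrow> (real ^ 'n) set" where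
  "half_cross_polytope k = {q. (\<Sum>i\<in>-{k}. \<bar>q $ i\<bar>) + q $ k \<le> 1 \<and> 0 \<le> q $ k}"

lemma compact_half_cross_polytope: "compact (half_cross_polytope k)"
proof -
  have "bounded (half_cross_polytope k)"
  proof (rule bounded_subset[OF bounded_cbox])
    show "half_cross_polytope k \<subseteq> cbox (\<chi> i. -1) (\<chi> i. 1)"
    proof
      fix q assume q: "q \<in> half_cross_polytope k"
      have "\<bar>q $ i\<bar> \<le> 1" for i
      proof (cases "i = k")
        case True
        have "0 \<le> (\<Sum>i\<in>-{k}. \<bar>q $ i\<bar>)" by (intro sum_nonneg) auto
        moreover have "(\<Sum>i\<in>-{k}. \<bar>q $ i\<bar>) + q $ k \<le> 1" "0 \<le> q $ k"
          using q by (simp_all add: half_cross_polytope_def)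
        ultimately have "\<bar>q $ k\<bar> \<le> 1" by linarith
        with True show ?thesis by simp
      next
        case False
        then have "\<bar>q $ i\<bar> \<le> (\<Sum>i\<in>-{k}. \<bar>q $ i\<bar>)" by (intro member_le_sum) auto
        with q show ?thesis by (auto simp: half_cross_polytope_def)
      qed
      then show "q \<in> cbox (\<chi> i. -1) (\<chi> i. 1)"
        by (auto simp: mem_box_cart abs_le_iff minus_le_iff)
    qed
  qed
  moreover have "closed (half_cross_polytope k)"
    unfolding half_cross_polytope_def
    by (intro closed_Collect_conj closed_Collect_le continuous_intros)
  ultimately show ?thesis by (simp add: compact_eq_bounded_closed)
qed

text \<open>Reflections in the coordinates \<open>i \<noteq> k\<close> divide it into copies of the unit simplex.\<close>

lemma measure_half_cross_polytope:
  fixes k :: "'n::finite"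
  shows "fact CARD('n) * measure lebesgue (half_cross_polytope k :: (real ^ 'n) set) = 2 ^ (CARD('n) - 1)"
proof -
  define C where "C I = {q \<in> half_cross_polytope k. \<forall>i\<in>I. 0 \<le> q $ i}" for I :: "'n set"
  have compact_C: "compact (C I)" for I
  proof -
    have "C I = half_cross_polytope k \<inter> (\<Inter>i\<in>I. {q. 0 \<le> q $ i})" by (auto simp: C_def)
    then show ?thesis
      by (simp only:) (intro compact_Int_closed compact_half_cross_polytope closed_INT ballI closed_Collect_le continuous_intros)
  qed
  have "measure lebesgue (C {}) = 2 ^ card I * measure lebesgue (C I)" if "finite I" "I \<subseteq> -{k}" for I
    using that
  proof (induction I rule: finite_induct)
    case (insert i I)
    define r :: "real ^ 'n \<Rightarrow> real ^ 'n" where "r q = (\<chi> j. if j = i then - q $ j else q $ j)" for q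
    have r: "linear r" "r (r q) = q" for q
      by (auto simp: r_def linear_iff vec_eq_iff)
    have "i \<noteq> k" using insert by auto
    then have "(\<Sum>j\<in>-{k}. \<bar>r q $ j\<bar>) + r q $ k = (\<Sum>j\<in>-{k}. \<bar>q $ j\<bar>) + q $ k" "r q $ k = q $ k" for q
      by (auto simp: r_def intro!: sum.cong split: if_splits)
    then have rC: "r q \<in> C (insert i I) \<longleftrightarrow> q \<in> half_cross_polytope k \<and> q $ i \<le> 0 \<and> (\<forall>j\<in>I. 0 \<le> q $ j)" for q
      using insert.hyps unfolding C_def half_cross_polytope_def
      by (auto simp: r_def)
    define R where "R = (\<lambda>q. 0 + r q) ` C (insert i I)"
    have R: "q \<in> R \<longleftrightarrow> r q \<in> C (insert i I)" for q
      using r(2) by (auto simp: R_def) (metis imageI)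
    have meas: "C (insert i I) \<in> lmeasurable" using compact_C by (rule lmeasurable_compact)
    have "C I = C (insert i I) \<union> R"
      unfolding set_eq_iff Un_iff R rC by (auto simp: C_def)
    moreover have "negligible (C (insert i I) \<inter> R)"
    proof (rule negligible_subset)
      show "negligible {q::real ^ 'n. q $ i = 0}"
        by (rule negligible_affine_form_zero[of _ "axis i 1"]) (simp_all add: linear_iff)
      show "C (insert i I) \<inter> R \<subseteq> {q. q $ i = 0}"
        unfolding subset_iff Int_iff R rC by (auto simp: C_def)
    qed
    moreover have "R \<in> lmeasurable" "measure lebesgue R = measure lebesgue (C (insert i I))"
      unfolding R_def using r meas
      by (intro lmeasurable_affine_image measure_affine_involution_image; simp)+
    ultimately have "measure lebesgue (C I) = 2 * measure lebesgue (C (insert i I))"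
      using meas by (simp add: measure_Un3 negligible_imp_measure0)
    then show ?case using insert by simp
  qed simp
  from this[of "-{k}"] have "measure lebesgue (C {}) = 2 ^ (CARD('n) - 1) * measure lebesgue (C (-{k}))"
    by (simp add: Compl_eq_Diff_UNIV card_Diff_singleton)
  moreover have "C (-{k}) = unit_simplex"
  proof -
    have "(\<Sum>i\<in>UNIV. q $ i) = (\<Sum>i\<in>-{k}. \<bar>q $ i\<bar>) + q $ k" if "\<forall>i\<in>-{k}. 0 \<le> q $ i" for q :: "real ^ 'n"
      using that by (simp add: sum.remove[of UNIV k] Compl_eq_Diff_UNIV)
    then show ?thesis
      unfolding C_def half_cross_polytope_def unit_simplex_def set_eq_iff
      by (auto; metis ComplI singletonD)
  qed
  moreover have "C {} = half_cross_polytope k" by (simp add: C_def)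
  ultimately show ?thesis by (simp add: measure_unit_simplex)
qed

text \<open>Vanishes on the tangent hyperplane of the paraboloid at \<open>z\<close> raised by \<open>1\<close>, and is positive below it. This hyperplane
  passes through the points of the paraboloid over the neighbours \<open>z \<plusminus> e\<^sub>i\<close>.\<close>

definition tip_form :: "'n::finite \<Rightarrow> ('n \<Rightarrow> int) \<Rightarrow> real ^ 'n \<Rightarrow> real" where
  "tip_form k z p = (\<Sum>i\<in>-{k}. 2 * of_int (z i) * p $ i - of_int (z i) ^ 2) + 1 - p $ k"

lemma linear_tip_form: "linear (\<lambda>p. tip_form k z p - tip_form k z 0)"
proof -
  have "tip_form k z p - tip_form k z 0 = (\<Sum>i\<in>-{k}. 2 * of_int (z i) * p $ i) - p $ k" for p
    by (simp add: tip_form_def sum_subtractf sum_negf)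
  then show ?thesis
    unfolding linear_iff by (simp only:) (simp add: sum.distrib sum_distrib_left algebra_simps)
qed

lemma sum_chord_square_ge_tip:
  "(\<Sum>i\<in>-{k}. 2 * of_int (z i) * p $ i - of_int (z i) ^ 2) \<le> (\<Sum>i\<in>-{k}. chord_square (p $ i))"
proof (rule sum_mono)
  fix i show "2 * of_int (z i) * p $ i - of_int (z i) ^ 2 \<le> chord_square (p $ i)"
    using chord_square_ge_abs[of "p $ i" "z i"] by linarith
qed

text \<open>The chord interpolation exceeds the tangent at \<open>z\<close> by at least the \<open>\<ell>\<^sup>1\<close>-distance from \<open>z\<close>. Hence the cap at \<open>z\<close> lives over
  the unit \<open>\<ell>\<^sup>1\<close>-ball around \<open>z\<close>, and caps at points of distance at least \<open>2\<close> do not interfere.\<close>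

lemma tip_form_le:
  assumes "p \<in> chord_region k L H"
  shows "tip_form k z p \<le> 1 - (\<Sum>i\<in>-{k}. \<bar>p $ i - of_int (z i)\<bar>)"
proof -
  have "(\<Sum>i\<in>-{k}. \<bar>p $ i - of_int (z i)\<bar> + (2 * of_int (z i) * p $ i - of_int (z i) ^ 2))
      \<le> (\<Sum>i\<in>-{k}. chord_square (p $ i))"
  proof (rule sum_mono)
    fix i show "\<bar>p $ i - of_int (z i)\<bar> + (2 * of_int (z i) * p $ i - of_int (z i) ^ 2) \<le> chord_square (p $ i)"
      using chord_square_ge_abs[of "p $ i" "z i"] by linarith
  qed
  also have "\<dots> \<le> p $ k" using assms by (simp add: chord_region_def)
  finally show ?thesis by (simp add: tip_form_def sum.distrib)
qed

text \<open>Together with \<open>tip_base\<close>, these are coordinates in which the cap at \<open>z\<close> becomes the half cross-polytope, the height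
  being measured downwards from the cutting hyperplane. With this orientation the linear part is an
  involution.\<close>

definition tip_shear :: "'n::finite \<Rightarrow> ('n \<Rightarrow> int) \<Rightarrow> real ^ 'n \<Rightarrow> real ^ 'n" where
  "tip_shear k z q = (\<chi> i. if i = k then 2 * (\<Sum>j\<in>-{k}. of_int (z j) * q $ j) - q $ k else q $ i)"

definition tip_base :: "'n::finite \<Rightarrow> ('n \<Rightarrow> int) \<Rightarrow> real ^ 'n" where
  "tip_base k z = (\<chi> i. if i = k then (\<Sum>j\<in>-{k}. of_int (z j) ^ 2) + 1 else of_int (z i))"

lemma linear_tip_shear: "linear (tip_shear k z)"
  by (rule linearI) (auto simp: tip_shear_def vec_eq_iff sum.distrib sum_distrib_left algebra_simps)

lemma tip_shear_involution: "tip_shear k z (tip_shear k z q) = q"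
proof -
  have "(\<Sum>j\<in>-{k}. of_int (z j) * tip_shear k z q $ j) = (\<Sum>j\<in>-{k}. of_int (z j) * q $ j)"
    by (intro sum.cong) (auto simp: tip_shear_def)
  then show ?thesis
    by (subst tip_shear_def) (simp add: vec_eq_iff, simp add: tip_shear_def)
qed

lemma tip_form_adapted: "tip_form k z (tip_base k z + tip_shear k z q) = q $ k"
proof -
  have "(\<Sum>i\<in>-{k}. 2 * of_int (z i) * (tip_base k z + tip_shear k z q) $ i - of_int (z i) ^ 2)
     = (\<Sum>i\<in>-{k}. of_int (z i) ^ 2 + 2 * (of_int (z i) * q $ i))"
    by (intro sum.cong) (auto simp: tip_base_def tip_shear_def algebra_simps power2_eq_square)
  then show ?thesis
    by (simp add: tip_form_def sum.distrib sum_distrib_left[symmetric]) (simp add: tip_base_def tip_shear_def)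
qed

lemma adapted_mem_chord_region:
  fixes k :: "'n::finite"
  assumes z: "\<And>i. i \<in> -{k} \<Longrightarrow> 1 \<le> z i \<and> z i < int L" and H: "real (chord_height TYPE('n) L) \<le> H"
    and q: "q \<in> half_cross_polytope k"
  shows "tip_base k z + tip_shear k z q \<in> chord_region k L H"
proof -
  let ?p = "tip_base k z + tip_shear k z q"
  have p: "?p $ i = of_int (z i) + q $ i" if "i \<in> -{k}" for i
    using that by (simp add: tip_base_def tip_shear_def)
  have q1: "\<bar>q $ i\<bar> \<le> 1" if "i \<in> -{k}" for i
  proof -
    have "\<bar>q $ i\<bar> \<le> (\<Sum>i\<in>-{k}. \<bar>q $ i\<bar>)" using that by (intro member_le_sum) auto
    with q show ?thesis by (auto simp: half_cross_polytope_def)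
  qed
  have box: "\<forall>i\<in>-{k}. 0 \<le> ?p $ i \<and> ?p $ i \<le> real L"
  proof
    fix i assume i: "i \<in> -{k}"
    have "1 \<le> real_of_int (z i)" "real_of_int (z i) + 1 \<le> real L" using z[OF i] by linarith+
    then show "0 \<le> ?p $ i \<and> ?p $ i \<le> real L" unfolding p[OF i] using q1[OF i] by linarith
  qed
  have form: "?p $ k = (\<Sum>i\<in>-{k}. 2 * of_int (z i) * ?p $ i - of_int (z i) ^ 2) + 1 - q $ k"
    using tip_form_adapted[of k z q] by (simp add: tip_form_def)
  have "(\<Sum>i\<in>-{k}. chord_square (?p $ i)) = (\<Sum>i\<in>-{k}. \<bar>q $ i\<bar> + (2 * of_int (z i) * ?p $ i - of_int (z i) ^ 2))"
  proof (rule sum.cong[OF refl])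
    fix i assume i: "i \<in> -{k}"
    then have "\<bar>?p $ i - of_int (z i)\<bar> = \<bar>q $ i\<bar>" unfolding p[OF i] by simp
    with q1[OF i] show "chord_square (?p $ i) = \<bar>q $ i\<bar> + (2 * of_int (z i) * ?p $ i - of_int (z i) ^ 2)"
      using chord_square_eq_abs[of "?p $ i" "z i"] by simp
  qed
  then have "(\<Sum>i\<in>-{k}. chord_square (?p $ i)) \<le> ?p $ k"
    using form q by (simp add: half_cross_polytope_def sum.distrib)
  moreover have "?p $ k \<le> H"
  proof -
    have "(\<Sum>i\<in>-{k}. 2 * of_int (z i) * ?p $ i - of_int (z i) ^ 2) \<le> (\<Sum>i\<in>-{k}. chord_square (?p $ i))"
      by (rule sum_chord_square_ge_tip)
    moreover have "0 \<le> q $ k" using q by (simp add: half_cross_polytope_def)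
    ultimately show ?thesis using form sum_chord_square_le_height[OF box] H by linarith
  qed
  ultimately show ?thesis using box by (simp add: chord_region_def)
qed

lemma adapted_coordinates:
  assumes "p \<in> chord_region k L H" "0 \<le> tip_form k z p"
  obtains q where "q \<in> half_cross_polytope k" "p = tip_base k z + tip_shear k z q"
proof
  let ?q = "tip_shear k z (p - tip_base k z)"
  show p: "p = tip_base k z + tip_shear k z ?q" by (simp add: tip_shear_involution)
  have "?q $ k = tip_form k z p"
    using tip_form_adapted[of k z ?q] p by simp
  moreover have "(\<Sum>i\<in>-{k}. \<bar>?q $ i\<bar>) = (\<Sum>i\<in>-{k}. \<bar>p $ i - of_int (z i)\<bar>)"
    by (intro sum.cong) (auto simp: tip_shear_def tip_base_def)
  ultimately show "?q \<in> half_cross_polytope k"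
    using tip_form_le[OF assms(1), of z] assms(2) by (simp add: half_cross_polytope_def)
qed

text \<open>In adapted coordinates the cap does not depend on \<open>z\<close>.\<close>

lemma measure_tip:
  fixes k :: "'n::finite"
  assumes z: "\<And>i. i \<in> -{k} \<Longrightarrow> 1 \<le> z i \<and> z i < int L" and H: "real (chord_height TYPE('n) L) \<le> H"
  shows "fact CARD('n) * measure lebesgue {p \<in> chord_region k L H :: (real ^ 'n) set. 0 \<le> tip_form k z p}
    = 2 ^ (CARD('n) - 1)"
proof -
  have "{p \<in> chord_region k L H. 0 \<le> tip_form k z p}
      = (\<lambda>q. tip_base k z + tip_shear k z q) ` half_cross_polytope k"
  proof (intro equalityI subsetI)
    fix p assume "p \<in> {p \<in> chord_region k L H. 0 \<le> tip_form k z p}"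
    then show "p \<in> (\<lambda>q. tip_base k z + tip_shear k z q) ` half_cross_polytope k"
      using adapted_coordinates[of p k L H z] by blast
  next
    fix p assume "p \<in> (\<lambda>q. tip_base k z + tip_shear k z q) ` half_cross_polytope k"
    then obtain q where q: "q \<in> half_cross_polytope k" "p = tip_base k z + tip_shear k z q" by blast
    moreover have "p \<in> chord_region k L H"
      unfolding q(2) using z H q(1) by (rule adapted_mem_chord_region)
    moreover have "tip_form k z p = q $ k" unfolding q(2) by (rule tip_form_adapted)
    ultimately show "p \<in> {p \<in> chord_region k L H. 0 \<le> tip_form k z p}"
      by (simp add: half_cross_polytope_def)
  qed
  then show ?thesis
    using measure_half_cross_polytope[of k]
      measure_affine_involution_image[OF linear_tip_shear tip_shear_involution
        lmeasurable_compact[OF compact_half_cross_polytope], of "tip_base k z" k z k]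
    by simp
qed

text \<open>In adapted coordinates the new face is the cross-polytope, where \<open>q\<close> is the combination of \<open>\<plusminus>e\<^sub>i\<close> with
  weights \<open>\<bar>q\<^sub>i\<bar>\<close> and of the centre with the remaining weight. The centre is itself a lattice point of the face, so it
  can serve as a generator; the index \<open>k\<close> is used for it.\<close>

lemma lattice_polytope_tip_face:
  fixes k :: "'n::finite"
  assumes z: "\<And>i. i \<in> -{k} \<Longrightarrow> 1 \<le> z i \<and> z i < int L" and H: "real (chord_height TYPE('n) L) \<le> H"
  shows "lattice_polytope {p \<in> chord_region k L H :: (real ^ 'n) set. tip_form k z p = 0}"
proof (rule lattice_polytopeI_hull)
  let ?F = "{p \<in> chord_region k L H :: (real ^ 'n) set. tip_form k z p = 0}"
  have "?F = chord_region k L H \<inter> {p. tip_form k z p \<le> 0} \<inter> {p. - tip_form k z p \<le> 0}" by auto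
  moreover have "linear (\<lambda>p. - tip_form k z p - - tip_form k z 0)"
    using linear_compose_neg[OF linear_tip_form[of k z]] by (simp add: algebra_simps)
  ultimately show "convex ?F"
    by (simp only:) (intro convex_Int compact_convex_chord_region convex_affine_form_le linear_tip_form)
  show "bounded ?F"
    by (rule bounded_subset[OF compact_imp_bounded[OF compact_convex_chord_region(1)]]) auto
  show "?F \<subseteq> convex hull (?F \<inter> integer_lattice)"
  proof
    fix p assume p: "p \<in> ?F"
    then obtain q where q: "q \<in> half_cross_polytope k" "p = tip_base k z + tip_shear k z q"
      using adapted_coordinates[of p k L H z] by auto
    have qk: "q $ k = 0" using p q(2) tip_form_adapted[of k z q] by simp
    \<comment> \<open>The generators: the centre for \<open>k\<close>, and otherwise the vertex on the axis \<open>i\<close> on the side of \<open>q\<close>.\<close>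
    define v :: "'n \<Rightarrow> real ^ 'n" where "v i = (if i = k then 0 else axis i (if q $ i < 0 then -1 else 1))" for i
    define X where "X i = tip_base k z + tip_shear k z (v i)" for i
    define w where "w i = (if i = k then 1 - (\<Sum>i\<in>-{k}. \<bar>q $ i\<bar>) else \<bar>q $ i\<bar>)" for i
    have w: "0 \<le> w i" for i using q(1) qk by (auto simp: w_def half_cross_polytope_def)
    have w1: "(\<Sum>i\<in>UNIV. w i) = 1"
      by (simp add: sum.remove[of UNIV k] Compl_eq_Diff_UNIV w_def)
    have "v i \<in> half_cross_polytope k \<and> v i $ k = 0" for i
    proof (cases "i = k")
      case False
      have "(\<Sum>j\<in>-{k}. \<bar>v i $ j\<bar>) = (\<Sum>j\<in>-{k}. if j = i then 1 else 0)"
        using False by (intro sum.cong) (auto simp: v_def axis_def)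
      with False show ?thesis by (simp add: half_cross_polytope_def) (simp add: v_def axis_def)
    qed (simp add: v_def half_cross_polytope_def)
    then have "X i \<in> ?F" for i
      using adapted_mem_chord_region[OF z H] by (auto simp: X_def tip_form_adapted)
    moreover have "v i \<in> integer_lattice" for i
      by (auto simp: v_def integer_lattice_def axis_def)
    then have "X i \<in> integer_lattice" for i
      unfolding X_def tip_base_def tip_shear_def integer_lattice_def
      by (auto intro!: Ints_add Ints_diff Ints_mult Ints_sum Ints_power)
    ultimately have "range X \<subseteq> ?F \<inter> integer_lattice" by auto
    moreover have "p = (\<Sum>i\<in>UNIV. w i *\<^sub>R X i)"
    proof -
      have "(\<Sum>i\<in>UNIV. w i *\<^sub>R v i) $ j = q $ j" for j
      proof -
        have "(\<Sum>i\<in>UNIV. w i *\<^sub>R v i) $ j = (\<Sum>i\<in>UNIV. if i = j then q $ j else 0)"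
          unfolding sum_component
          by (intro sum.cong) (auto simp: w_def v_def axis_def qk)
        then show ?thesis by simp
      qed
      then have "(\<Sum>i\<in>UNIV. w i *\<^sub>R v i) = q" by (simp add: vec_eq_iff)
      moreover have "(\<Sum>i\<in>UNIV. w i *\<^sub>R X i) = tip_base k z + tip_shear k z (\<Sum>i\<in>UNIV. w i *\<^sub>R v i)"
        using w1 linear_tip_shear[of k z]
        by (simp add: X_def scaleR_add_right sum.distrib linear_sum linear_scale flip: scaleR_sum_left)
      ultimately show ?thesis using q by simp
    qed
    ultimately show "p \<in> convex hull (?F \<inter> integer_lattice)"
      using convex_combination_in_hull[of w X, OF w w1] hull_mono[of "range X" _ convex]
      by (metis (no_types, lifting) subsetD)
  qed
qed

definition dented_region :: "'n::finite \<Rightarrow> nat \<Rightarrow> real \<Rightarrow> ('n \<Rightarrow> int) set \<Rightarrow> (real ^ 'n) set" where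
  "dented_region k L H T = {p \<in> chord_region k L H. \<forall>z\<in>T. tip_form k z p \<le> 0}"

lemma lattice_polytope_dented_region:
  fixes k :: "'n::finite"
  assumes T: "finite T" "\<And>z i. z \<in> T \<Longrightarrow> i \<in> -{k} \<Longrightarrow> 1 \<le> z i \<and> z i < int L"
    and sep: "\<And>z z'. z \<in> T \<Longrightarrow> z' \<in> T \<Longrightarrow> z \<noteq> z' \<Longrightarrow> 2 \<le> (\<Sum>i\<in>-{k}. \<bar>z i - z' i\<bar>)"
    and H: "H \<in> \<int>" "real (chord_height TYPE('n) L) \<le> H"
  shows "lattice_polytope (dented_region k L H T :: (real ^ 'n) set)"
    "fact CARD('n) * measure lebesgue (dented_region k L H T :: (real ^ 'n) set)
      = fact CARD('n) * measure lebesgue (chord_region k L H :: (real ^ 'n) set) - 2 ^ (CARD('n) - 1) * real (card T)"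
proof -
  let ?B = "chord_region k L H :: (real ^ 'n) set"
  have "lattice_polytope {p \<in> ?B. \<forall>z\<in>T. tip_form k z p \<le> 0} \<and>
    measure lebesgue {p \<in> ?B. \<forall>z\<in>T. tip_form k z p \<le> 0}
      = measure lebesgue ?B - (\<Sum>z\<in>T. measure lebesgue {p \<in> ?B. 0 \<le> tip_form k z p})"
  proof (rule lattice_polytope_cuts[OF T(1) lattice_polytope_chord_region[OF H] linear_tip_form])
    fix z assume "z \<in> T"
    then show "lattice_polytope {p \<in> ?B. tip_form k z p = 0}"
      using T(2) H by (intro lattice_polytope_tip_face) auto
    show "\<exists>u. tip_form k z u \<noteq> tip_form k z 0"
      by (rule exI[of _ "axis k 1"]) (simp add: tip_form_def axis_def)
  next
    fix z z' p assume *: "z \<in> T" "z' \<in> T" "z \<noteq> z'" "p \<in> ?B" "0 \<le> tip_form k z p"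
    have "2 \<le> real_of_int (\<Sum>i\<in>-{k}. \<bar>z i - z' i\<bar>)" using sep[OF *(1-3)] by linarith
    also have "\<dots> = (\<Sum>i\<in>-{k}. \<bar>real_of_int (z i) - of_int (z' i)\<bar>)" by simp
    also have "\<dots> \<le> (\<Sum>i\<in>-{k}. \<bar>p $ i - of_int (z i)\<bar> + \<bar>p $ i - of_int (z' i)\<bar>)"
      by (intro sum_mono) linarith
    finally show "tip_form k z' p \<le> 0"
      using tip_form_le[OF *(4), of z] tip_form_le[OF *(4), of z'] *(5) by (simp add: sum.distrib)
  qed
  moreover have "fact CARD('n) * (\<Sum>z\<in>T. measure lebesgue {p \<in> ?B. 0 \<le> tip_form k z p})
      = 2 ^ (CARD('n) - 1) * real (card T)"
  proof -
    have "fact CARD('n) * measure lebesgue {p \<in> ?B. 0 \<le> tip_form k z p} = 2 ^ (CARD('n) - 1)" if "z \<in> T" for z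
      using T(2)[OF that] H(2) by (rule measure_tip)
    then show ?thesis by (simp add: sum_distrib_left)
  qed
  ultimately show "lattice_polytope (dented_region k L H T :: (real ^ 'n) set)"
    "fact CARD('n) * measure lebesgue (dented_region k L H T :: (real ^ 'n) set)
      = fact CARD('n) * measure lebesgue ?B - 2 ^ (CARD('n) - 1) * real (card T)"
    unfolding dented_region_def by (auto simp: right_diff_distrib)
qed

text \<open>All dents lie below \<open>chord_height\<close>, so the upper part is a box.\<close>

lemma mem_dented_region_top:
  fixes p :: "real ^ 'n"
  assumes box: "\<forall>i\<in>-{k}. 0 \<le> p $ i \<and> p $ i \<le> real L"
    and h: "real (chord_height TYPE('n) L) \<le> p $ k" "p $ k \<le> H"
  shows "p \<in> dented_region k L H T"
proof -
  have "tip_form k z p \<le> 0" for z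
    using sum_chord_square_ge_tip[of z p k] sum_chord_square_le_height[OF box] h(1)
    by (simp add: tip_form_def)
  moreover have "p \<in> chord_region k L H"
    using box h sum_chord_square_le_height[OF box] by (simp add: chord_region_def)
  ultimately show ?thesis by (simp add: dented_region_def)
qed

text \<open>The lattice point of the paraboloid over \<open>z\<close>.\<close>

definition tip :: "'n::finite \<Rightarrow> ('n \<Rightarrow> int) \<Rightarrow> real ^ 'n" where
  "tip k z = (\<chi> i. if i = k then (\<Sum>j\<in>-{k}. of_int (z j) ^ 2) else of_int (z i))"

lemma tip_eq_adapted: "tip k z = tip_base k z + tip_shear k z (axis k 1)"
proof -
  have "(\<Sum>j\<in>-{k}. of_int (z j) * axis k (1::real) $ j) = 0"
    by (intro sum.neutral) (auto simp: axis_def)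
  then show ?thesis
    by (simp add: tip_def tip_base_def tip_shear_def vec_eq_iff) (simp add: axis_def)
qed

text \<open>Hence the set of removed points can be read off the polytope.\<close>

lemma tip_mem_dented_region_iff:
  fixes k :: "'n::finite"
  assumes z: "\<And>i. i \<in> -{k} \<Longrightarrow> 1 \<le> z i \<and> z i < int L" and H: "real (chord_height TYPE('n) L) \<le> H"
    and sep: "\<And>z'. z' \<in> T \<Longrightarrow> z \<noteq> z' \<Longrightarrow> 2 \<le> (\<Sum>i\<in>-{k}. \<bar>z i - z' i\<bar>)"
  shows "tip k z \<in> chord_region k L H" "tip k z \<in> dented_region k L H T \<longleftrightarrow> z \<notin> T"
proof -
  have "axis k 1 \<in> half_cross_polytope k"
    by (simp add: half_cross_polytope_def) (simp add: axis_def)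
  then show reg: "tip k z \<in> chord_region k L H"
    unfolding tip_eq_adapted using z H by (intro adapted_mem_chord_region) auto
  have "tip_form k z (tip k z) = 1"
    unfolding tip_eq_adapted tip_form_adapted by simp
  moreover have "tip_form k z' (tip k z) \<le> 0" if "z' \<in> T" "z \<noteq> z'" for z'
  proof -
    have "2 \<le> real_of_int (\<Sum>i\<in>-{k}. \<bar>z i - z' i\<bar>)" using sep[OF that] by linarith
    also have "\<dots> = (\<Sum>i\<in>-{k}. \<bar>tip k z $ i - of_int (z' i)\<bar>)"
      unfolding of_int_sum by (intro sum.cong) (auto simp: tip_def)
    finally show ?thesis using tip_form_le[OF reg, of z'] by linarith
  qed
  ultimately show "tip k z \<in> dented_region k L H T \<longleftrightarrow> z \<notin> T"
    using reg by (fastforce simp: dented_region_def)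
qed

text \<open>Even coordinates keep distinct points at \<open>\<ell>\<^sup>1\<close>-distance at least \<open>2\<close>.\<close>

definition dent_grid :: "'n::finite \<Rightarrow> nat \<Rightarrow> ('n \<Rightarrow> int) set" where
  "dent_grid k m = (-{k}) \<rightarrow>\<^sub>E (\<lambda>a. 2 * a) ` {1..int m}"

lemma dent_grid_properties:
  fixes k :: "'n::finite"
  shows "finite (dent_grid k m)" "card (dent_grid k m) = m ^ (CARD('n) - 1)"
    "\<And>z i. z \<in> dent_grid k m \<Longrightarrow> i \<in> -{k} \<Longrightarrow> 1 \<le> z i \<and> z i < int (4 * m)"
    "\<And>z z'. z \<in> dent_grid k m \<Longrightarrow> z' \<in> dent_grid k m \<Longrightarrow> z \<noteq> z' \<Longrightarrow> 2 \<le> (\<Sum>i\<in>-{k}. \<bar>z i - z' i\<bar>)"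
proof -
  show "finite (dent_grid k m)" unfolding dent_grid_def by (intro finite_PiE) auto
  have "card ((\<lambda>a::int. 2 * a) ` {1..int m}) = m"
    by (subst card_image) (auto simp: inj_on_def)
  then show "card (dent_grid k m) = m ^ (CARD('n) - 1)"
    by (simp add: dent_grid_def card_PiE Compl_eq_Diff_UNIV card_Diff_singleton)
  show "1 \<le> z i \<and> z i < int (4 * m)" if "z \<in> dent_grid k m" "i \<in> -{k}" for z i
  proof -
    have "z i \<in> (\<lambda>a. 2 * a) ` {1..int m}" using that unfolding dent_grid_def by (rule PiE_mem)
    then show ?thesis by auto
  qed
  show "2 \<le> (\<Sum>i\<in>-{k}. \<bar>z i - z' i\<bar>)" if zz: "z \<in> dent_grid k m" "z' \<in> dent_grid k m" "z \<noteq> z'" for z z'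
  proof -
    obtain i where i: "i \<in> -{k}" "z i \<noteq> z' i"
      using PiE_ext[OF zz(1,2)[unfolded dent_grid_def]] zz(3) by auto
    have "z i \<in> (\<lambda>a. 2 * a) ` {1..int m}" "z' i \<in> (\<lambda>a. 2 * a) ` {1..int m}"
      using zz i unfolding dent_grid_def by (auto intro: PiE_mem)
    with i(2) have "2 \<le> \<bar>z i - z' i\<bar>" by auto
    also have "\<dots> \<le> (\<Sum>i\<in>-{k}. \<bar>z i - z' i\<bar>)" using i by (intro member_le_sum) auto
    finally show ?thesis .
  qed
qed

section \<open>Trimming the corners of a box\<close>

text \<open>Coordinates at a corner \<open>v\<close> whose edges run along the axes, with signed leg lengths \<open>l\<close>: the unit simplex is mapped
  to the simplex that the corner cut removes.\<close>

definition corner_map :: "real ^ 'n \<Rightarrow> real ^ 'n \<Rightarrow> real ^ 'n \<Rightarrow> real ^ 'n" where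
  "corner_map v l x = v + (\<chi> i. l $ i * x $ i)"

definition corner_form :: "real ^ 'n \<Rightarrow> real ^ 'n \<Rightarrow> real ^ 'n \<Rightarrow> real" where
  "corner_form v l p = 1 - (\<Sum>i\<in>UNIV. (p $ i - v $ i) / l $ i)"

lemma linear_corner_form: "linear (\<lambda>p. corner_form v l p - corner_form v l 0)"
proof -
  have "corner_form v l p - corner_form v l 0 = - (\<Sum>i\<in>UNIV. p $ i / l $ i)" for p
    by (simp add: corner_form_def diff_divide_distrib sum_subtractf sum_negf)
  then show ?thesis
    unfolding linear_iff
    by (simp only:) (simp add: add_divide_distrib sum.distrib sum_distrib_left)
qed

lemma corner_form_not_const:
  assumes "l $ i \<noteq> 0"
  shows "corner_form v l (axis i 1) \<noteq> corner_form v l 0"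
proof -
  have "corner_form v l (axis i 1) = corner_form v l 0 - (\<Sum>j\<in>UNIV. axis i 1 $ j / l $ j)"
    by (simp add: corner_form_def diff_divide_distrib sum_subtractf sum_negf)
  also have "(\<Sum>j\<in>UNIV. axis i 1 $ j / l $ j) = (\<Sum>j\<in>UNIV. if j = i then 1 / l $ i else 0)"
    by (intro sum.cong) (auto simp: axis_def)
  finally show ?thesis using assms by simp
qed

text \<open>The hypothesis \<open>cone\<close> says that \<open>B\<close> lies in the cone of the corner, and \<open>inside\<close> that the removed simplex lies in \<open>B\<close>.\<close>

lemma corner_cap:
  fixes B :: "(real ^ 'n) set"
  assumes B: "lattice_polytope B"
    and l: "\<And>i. l $ i \<noteq> 0" "l \<in> integer_lattice" and v: "v \<in> integer_lattice"
    and inside: "\<And>x. x \<in> unit_simplex \<Longrightarrow> corner_map v l x \<in> B"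
    and cone: "\<And>p i. p \<in> B \<Longrightarrow> 0 \<le> (p $ i - v $ i) / l $ i"
  shows "fact CARD('n) * measure lebesgue {p \<in> B. 0 \<le> corner_form v l p} = (\<Prod>i\<in>UNIV. \<bar>l $ i\<bar>)"
    "lattice_polytope {p \<in> B. corner_form v l p = 0}"
proof -
  define co where "co p = (\<chi> i. (p $ i - v $ i) / l $ i)" for p :: "real ^ 'n"
  have co: "corner_map v l (co p) = p" for p
    using l by (simp add: corner_map_def co_def vec_eq_iff)
  have form: "corner_form v l (corner_map v l x) = 1 - (\<Sum>i\<in>UNIV. x $ i)" for x
    using l by (simp add: corner_form_def corner_map_def)
  have co_mem: "co p \<in> unit_simplex" if "p \<in> B" "0 \<le> corner_form v l p" for p
    using cone[OF that(1)] that(2) by (auto simp: unit_simplex_def co_def corner_form_def)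
  have "{p \<in> B. 0 \<le> corner_form v l p} = corner_map v l ` unit_simplex"
  proof (intro equalityI subsetI)
    fix p assume "p \<in> {p \<in> B. 0 \<le> corner_form v l p}"
    then show "p \<in> corner_map v l ` unit_simplex"
      using co_mem[of p] co[of p] by (metis (no_types, lifting) imageI mem_Collect_eq)
  next
    fix p assume "p \<in> corner_map v l ` unit_simplex"
    then obtain x where x: "x \<in> unit_simplex" "p = corner_map v l x" by blast
    then show "p \<in> {p \<in> B. 0 \<le> corner_form v l p}"
      using inside[OF x(1)] form[of x] by (auto simp: unit_simplex_def)
  qed
  moreover have "measure lebesgue (corner_map v l ` unit_simplex)
      = measure lebesgue ((\<lambda>x::real ^ 'n. \<chi> i. l $ i * x $ i) ` unit_simplex)"
    using measure_translation[of v "(\<lambda>x::real ^ 'n. \<chi> i. l $ i * x $ i) ` unit_simplex"]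
    by (simp add: image_image corner_map_def[abs_def])
  ultimately show "fact CARD('n) * measure lebesgue {p \<in> B. 0 \<le> corner_form v l p} = (\<Prod>i\<in>UNIV. \<bar>l $ i\<bar>)"
    by (simp add: measure_stretch lmeasurable_unit_simplex measure_unit_simplex abs_prod)
  let ?F = "{p \<in> B. corner_form v l p = 0}"
  show "lattice_polytope ?F"
  proof (rule lattice_polytopeI_hull)
    have "?F = B \<inter> {p. corner_form v l p \<le> 0} \<inter> {p. - corner_form v l p \<le> 0}" by auto
    moreover have "linear (\<lambda>p. - corner_form v l p - - corner_form v l 0)"
      using linear_compose_neg[OF linear_corner_form[of v l]] by (simp add: algebra_simps)
    ultimately show "convex ?F"
      by (simp only:) (intro convex_Int lattice_polytope_compact_convex[OF B] convex_affine_form_le linear_corner_form)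
    show "bounded ?F"
      by (rule bounded_subset[OF compact_imp_bounded[OF lattice_polytope_compact_convex(1)[OF B]]]) auto
    show "?F \<subseteq> convex hull (?F \<inter> integer_lattice)"
    proof
      fix p assume p: "p \<in> ?F"
      define X where "X i = corner_map v l (axis i 1)" for i
      have "axis i 1 \<in> (unit_simplex :: (real ^ 'n) set)" "(\<Sum>j\<in>UNIV. axis i 1 $ j) = (1::real)" for i :: 'n
        by (simp_all add: unit_simplex_def axis_def)
      then have "X i \<in> ?F" for i
        using inside form[of "axis i 1"] by (simp add: X_def)
      moreover have "X i \<in> integer_lattice" for i
        using l v by (auto simp: X_def corner_map_def integer_lattice_def axis_def)
      ultimately have X: "range X \<subseteq> ?F \<inter> integer_lattice" by auto
      have w: "0 \<le> co p $ i" for i using co_mem[of p] p by (auto simp: unit_simplex_def)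
      have w1: "(\<Sum>i\<in>UNIV. co p $ i) = 1" using p by (simp add: co_def corner_form_def)
      have "(\<Sum>i\<in>UNIV. co p $ i *\<^sub>R X i) = p"
      proof -
        have "(\<Sum>i\<in>UNIV. co p $ i *\<^sub>R X i) $ j = p $ j" for j
        proof -
          have "(\<Sum>i\<in>UNIV. co p $ i *\<^sub>R X i) $ j = (\<Sum>i\<in>UNIV. co p $ i * v $ j + (if i = j then co p $ j * l $ j else 0))"
            unfolding sum_component
            by (intro sum.cong) (auto simp: X_def corner_map_def axis_def algebra_simps)
          also have "\<dots> = v $ j + co p $ j * l $ j"
            by (simp add: sum.distrib w1 flip: sum_distrib_right)
          also have "\<dots> = p $ j" using l by (simp add: co_def)
          finally show ?thesis .
        qed
        then show ?thesis by (simp add: vec_eq_iff)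
      qed
      then show "p \<in> convex hull (?F \<inter> integer_lattice)"
        using convex_combination_in_hull[of "\<lambda>i. co p $ i" X, OF w w1] hull_mono[OF X, of convex] by auto
    qed
  qed
qed

text \<open>A corner of the top for each index: \<open>k\<close> stands for the one over the origin, and \<open>j \<noteq> k\<close> for its neighbour in
  direction \<open>j\<close>.\<close>

definition box_vertex :: "'n::finite \<Rightarrow> nat \<Rightarrow> real \<Rightarrow> 'n \<Rightarrow> real ^ 'n" where
  "box_vertex k L H j = (\<chi> i. if i = k then H else if i = j then real L else 0)"

text \<open>The corner with position \<open>pos j\<close> gets exactly \<open>pos j\<close> legs of length \<open>m\<close>. As \<open>k\<close> has the last position, these never
  include the vertical leg, which has the free length \<open>t\<close>.\<close>

definition box_legs :: "'n::finite \<Rightarrow> nat \<Rightarrow> ('n \<Rightarrow> nat) \<Rightarrow> nat \<Rightarrow> 'n \<Rightarrow> real ^ 'n" where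
  "box_legs k m pos t j =
    (\<chi> i. if i = k then - real t else (if i = j then -1 else 1) * (if pos i < pos j then real m else 1))"

text \<open>Legs are at most \<open>m\<close> in the horizontal directions and \<open>2 m \<le> L\<close>, so the simplices at different corners do not
  interfere; the one at corner \<open>j\<close> has normalised volume \<open>t j * m ^ pos j\<close>. For \<open>t j = 0\<close> the simplex is
  degenerate, and nothing is cut off.\<close>

lemma trim_corners:
  fixes B :: "(real ^ 'n) set" and k :: 'n and pos t :: "'n \<Rightarrow> nat"
  assumes B: "lattice_polytope B"
    and below: "\<And>p. p \<in> B \<Longrightarrow> (\<forall>i\<in>-{k}. 0 \<le> p $ i \<and> p $ i \<le> real L) \<and> p $ k \<le> H"
    and top: "\<And>p. (\<forall>i\<in>-{k}. 0 \<le> p $ i \<and> p $ i \<le> real L) \<Longrightarrow> Y \<le> p $ k \<Longrightarrow> p $ k \<le> H \<Longrightarrow> p \<in> B"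
    and m: "1 \<le> m" "2 * m \<le> L" and H: "H \<in> \<int>"
    and t: "\<And>j. real (t j) \<le> H - Y"
    and pos: "bij_betw pos UNIV {..<CARD('n)}" "pos k = CARD('n) - 1"
  obtains Q where "lattice_polytope Q" "Q \<subseteq> B" "\<And>p. p \<in> B \<Longrightarrow> p $ k \<le> Y \<Longrightarrow> p \<in> Q"
    "fact CARD('n) * measure lebesgue Q = fact CARD('n) * measure lebesgue B - (\<Sum>j\<in>UNIV. real (t j * m ^ pos j))"
proof -
  define I where "I = {j. 0 < t j}"
  define h where "h j = corner_form (box_vertex k L H j) (box_legs k m pos (t j) j)" for j
  let ?v = "\<lambda>j. box_vertex k L H j" and ?l = "\<lambda>j. box_legs k m pos (t j) j"
  have l0: "?l j $ i \<noteq> 0" if "j \<in> I" for j i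
    using that m by (auto simp: box_legs_def I_def)
  have lint: "?l j \<in> integer_lattice" for j by (simp add: box_legs_def integer_lattice_def)
  have vint: "?v j \<in> integer_lattice" for j using H by (simp add: box_vertex_def integer_lattice_def)
  have cone: "0 \<le> (p $ i - ?v j $ i) / ?l j $ i" if "p \<in> B" for p i j
    using below[OF that] m
    by (auto simp: box_vertex_def box_legs_def divide_simps)
  have inside: "corner_map (?v j) (?l j) x \<in> B" if "x \<in> unit_simplex" for x j
  proof (rule top)
    have x: "0 \<le> x $ i" "x $ i \<le> 1" for i
    proof -
      show "0 \<le> x $ i" using that by (simp add: unit_simplex_def)
      have "x $ i \<le> (\<Sum>i\<in>UNIV. x $ i)" using that by (intro member_le_sum) (auto simp: unit_simplex_def)
      then show "x $ i \<le> 1" using that by (simp add: unit_simplex_def)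
    qed
    have mL: "real m \<le> real L" "1 \<le> real m" using m by auto
    have "0 \<le> c * x $ i \<and> c * x $ i \<le> real L" if "c = real m \<or> c = 1" for c i
      using that x[of i] mL mult_mono[of c "real L" "x $ i" 1] by auto
    then show "\<forall>i\<in>-{k}. 0 \<le> corner_map (?v j) (?l j) x $ i \<and> corner_map (?v j) (?l j) x $ i \<le> real L"
      by (auto simp: corner_map_def box_vertex_def box_legs_def) (metis mult_1)+
    have "0 \<le> real (t j) * x $ k" "real (t j) * x $ k \<le> real (t j)"
      using x[of k] mult_left_le by (auto intro: mult_left_le)
    then show "Y \<le> corner_map (?v j) (?l j) x $ k" "corner_map (?v j) (?l j) x $ k \<le> H"
      using t[of j] by (auto simp: corner_map_def box_vertex_def box_legs_def)
  qed
  have cap: "fact CARD('n) * measure lebesgue {p \<in> B. 0 \<le> h j p} = real (t j * m ^ pos j)"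
    "lattice_polytope {p \<in> B. h j p = 0}" if j: "j \<in> I" for j
  proof -
    have "(\<Prod>i\<in>UNIV. \<bar>?l j $ i\<bar>) = real (t j) * (\<Prod>i\<in>-{k}. if pos i < pos j then real m else 1)"
      by (subst prod.remove[of UNIV k]) (auto simp: box_legs_def Compl_eq_Diff_UNIV intro!: prod.cong split: if_splits)
    also have "(\<Prod>i\<in>-{k}. if pos i < pos j then real m else 1) = real m ^ card {i. pos i < pos j}"
    proof -
      have "pos i < CARD('n)" for i using pos(1) by (auto dest: bij_betwE)
      then have "\<not> pos k < pos j" using pos(2) by (metis Suc_pred' not_less_eq zero_less_card_finite)
      then have "{i \<in> -{k}. pos i < pos j} = {i. pos i < pos j}" by auto
      then show ?thesis
        by (simp add: prod.If_cases Int_def)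
    qed
    also have "card {i. pos i < pos j} = pos j"
    proof -
      have "pos ` {i. pos i < pos j} = {..<pos j}"
      proof (intro equalityI subsetI)
        fix a assume "a \<in> {..<pos j}"
        moreover have "pos j < CARD('n)" using pos(1) by (auto dest: bij_betwE)
        ultimately have "a \<in> pos ` UNIV" using pos(1) by (simp add: bij_betw_def)
        then show "a \<in> pos ` {i. pos i < pos j}" using \<open>a \<in> {..<pos j}\<close> by auto
      qed auto
      moreover have "inj_on pos {i. pos i < pos j}"
        using pos(1) by (meson bij_betw_def inj_on_subset subset_UNIV)
      ultimately show ?thesis by (metis card_image card_lessThan)
    qed
    finally have "(\<Prod>i\<in>UNIV. \<bar>?l j $ i\<bar>) = real (t j * m ^ pos j)" by simp
    then show "fact CARD('n) * measure lebesgue {p \<in> B. 0 \<le> h j p} = real (t j * m ^ pos j)"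
      "lattice_polytope {p \<in> B. h j p = 0}"
      using corner_cap[OF B l0[OF j] lint vint inside cone] unfolding h_def by simp_all
  qed
  have one_le: "h j p \<le> 0" if "p \<in> B" "1 \<le> (p $ i - ?v j $ i) / ?l j $ i" for p i j
  proof -
    have "(p $ i - ?v j $ i) / ?l j $ i \<le> (\<Sum>i\<in>UNIV. (p $ i - ?v j $ i) / ?l j $ i)"
      using cone[OF that(1)] by (intro member_le_sum) auto
    with that(2) show ?thesis by (simp add: h_def corner_form_def)
  qed
  have near: "(p $ i - ?v j $ i) / ?l j $ i \<le> 1" if "p \<in> B" "0 \<le> h j p" for p i j
  proof -
    have "(p $ i - ?v j $ i) / ?l j $ i \<le> (\<Sum>i\<in>UNIV. (p $ i - ?v j $ i) / ?l j $ i)"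
      using cone[OF that(1)] by (intro member_le_sum) auto
    with that(2) show ?thesis by (simp add: h_def corner_form_def)
  qed
  have disj: "h j p \<le> 0" if "p \<in> B" "0 \<le> h i p" "i \<noteq> j" for i j p
  proof -
    have mL: "2 * real m \<le> real L" "1 \<le> real m" using m by auto
    have far: "1 \<le> a / c" if "real m \<le> a" "c = real m \<or> c = 1" for a c :: real
      using that mL by (auto simp: divide_simps)
    have close: "a \<le> real m" if "a / c \<le> 1" "c = real m \<or> c = 1" for a c :: real
      using that mL by (auto simp: divide_simps split: if_splits)
    show ?thesis
    proof (cases "j = k")
      case False
      have "p $ j / (if pos j < pos i then real m else 1) \<le> 1"
        using near[OF that(1,2), of j] False that(3) by (simp add: box_vertex_def box_legs_def)
      then have "p $ j \<le> real m" by (rule close) auto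
      then have "1 \<le> (real L - p $ j) / 1" using mL by (intro far) auto
      then have "1 \<le> (p $ j - ?v j $ j) / ?l j $ j"
        using False by (simp add: box_vertex_def box_legs_def)
      then show ?thesis using one_le that(1) by blast
    next
      case True
      then have "i \<noteq> k" using that(3) by simp
      have "real L - p $ i \<le> 1"
        using near[OF that(1,2), of i] \<open>i \<noteq> k\<close> by (simp add: box_vertex_def box_legs_def)
      then have "1 \<le> p $ i / (if pos i < pos j then real m else 1)" using mL by (intro far) auto
      then have "1 \<le> (p $ i - ?v j $ i) / ?l j $ i"
        using \<open>i \<noteq> k\<close> that(3) by (simp add: box_vertex_def box_legs_def)
      then show ?thesis using one_le that(1) by blast
    qed
  qed
  let ?Q = "{p \<in> B. \<forall>j\<in>I. h j p \<le> 0}"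
  have Q: "lattice_polytope ?Q \<and> measure lebesgue ?Q
      = measure lebesgue B - (\<Sum>j\<in>I. measure lebesgue {p \<in> B. 0 \<le> h j p})"
  proof (rule lattice_polytope_cuts[OF _ B])
    fix j assume j: "j \<in> I"
    show "linear (\<lambda>p. h j p - h j 0)" unfolding h_def by (rule linear_corner_form)
    show "\<exists>u. h j u \<noteq> h j 0" unfolding h_def using corner_form_not_const[OF l0[OF j]] by blast
  qed (use cap disj in auto)
  show thesis
  proof (rule that[of ?Q])
    fix p assume p: "p \<in> B" "p $ k \<le> Y"
    have "h j p \<le> 0" if "j \<in> I" for j
    proof (rule one_le[OF p(1)])
      have "real (t j) \<le> H - p $ k" using t[of j] p(2) by linarith
      then show "1 \<le> (p $ k - ?v j $ k) / ?l j $ k"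
        using that by (simp add: box_vertex_def box_legs_def I_def divide_simps)
    qed
    then show "p \<in> ?Q" using p by auto
  next
    have "fact CARD('n) * (\<Sum>j\<in>I. measure lebesgue {p \<in> B. 0 \<le> h j p}) = (\<Sum>j\<in>I. real (t j * m ^ pos j))"
      using cap(1) by (simp add: sum_distrib_left)
    also have "\<dots> = (\<Sum>j\<in>UNIV. real (t j * m ^ pos j))"
      by (intro sum.mono_neutral_left) (auto simp: I_def)
    finally show "fact CARD('n) * measure lebesgue ?Q
        = fact CARD('n) * measure lebesgue B - (\<Sum>j\<in>UNIV. real (t j * m ^ pos j))"
      using Q by (simp add: right_diff_distrib)
  qed (use Q in auto)
qed

section \<open>Finitely many classes of given volume\<close>

lemma matrix_inv_vector:
  fixes M :: "real ^ 'n ^ 'n"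
  assumes "invertible M"
  shows "M *v (matrix_inv M *v x) = x" "matrix_inv M *v (M *v x) = x"
proof -
  have "M ** matrix_inv M = mat 1 \<and> matrix_inv M ** M = mat 1"
    using assms unfolding invertible_def matrix_inv_def by (rule someI_ex)
  then show "M *v (matrix_inv M *v x) = x" "matrix_inv M *v (M *v x) = x"
    by (simp_all add: matrix_vector_mul_assoc)
qed

text \<open>The columns are the edges from \<open>a\<close> of the simplex with vertices \<open>a\<close> and \<open>f j\<close>.\<close>

definition edge_matrix :: "real ^ 'n \<Rightarrow> ('n \<Rightarrow> real ^ 'n) \<Rightarrow> real ^ 'n ^ 'n" where
  "edge_matrix a f = (\<chi> i j. f j $ i - a $ i)"

lemma edge_matrix_axis: "edge_matrix a f *v axis j 1 = f j - a"
  by (simp add: edge_matrix_def matrix_vector_mult_basis column_def vec_eq_iff)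

lemma edge_matrix_mult: "edge_matrix a f *v x = (\<Sum>j\<in>UNIV. x $ j *\<^sub>R (f j - a))"
  by (simp add: vec_eq_iff matrix_vector_mult_def edge_matrix_def mult.commute)

text \<open>The simplex is contained in \<open>P\<close>. In the proof, its \<open>d + 1\<close> vertices are indexed by the option type.\<close>

lemma measure_simplex_le:
  fixes P :: "(real ^ 'n) set"
  assumes P: "convex P" "P \<in> lmeasurable" and "a \<in> P" "\<And>j. f j \<in> P"
  shows "\<bar>det (edge_matrix a f)\<bar> \<le> fact CARD('n) * measure lebesgue P"
proof -
  have "(\<lambda>x. a + edge_matrix a f *v x) ` unit_simplex \<subseteq> P"
  proof clarify
    fix x :: "real ^ 'n" assume x: "x \<in> unit_simplex"
    define s where "s = (\<Sum>j\<in>UNIV. x $ j)"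
    define w where "w o' = (case o' of None \<Rightarrow> 1 - s | Some j \<Rightarrow> x $ j)" for o'
    define y where "y o' = (case o' of None \<Rightarrow> a | Some j \<Rightarrow> f j)" for o'
    have "(\<Sum>o'\<in>UNIV. w o' *\<^sub>R y o') \<in> P"
      using x assms
      by (intro convex_sum) (auto simp: w_def y_def UNIV_option_conv sum.reindex s_def unit_simplex_def split: option.splits)
    moreover have "(\<Sum>o'\<in>UNIV. w o' *\<^sub>R y o') = a + edge_matrix a f *v x"
      by (simp add: w_def y_def UNIV_option_conv sum.reindex edge_matrix_mult s_def
          scaleR_diff_right scaleR_diff_left sum_subtractf scaleR_sum_left)
    ultimately show "a + edge_matrix a f *v x \<in> P" by simp
  qed
  moreover have lin: "linear ((*v) (edge_matrix a f))" by (rule matrix_vector_mul_linear)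
  ultimately have "measure lebesgue ((\<lambda>x. a + edge_matrix a f *v x) ` unit_simplex) \<le> measure lebesgue P"
    using P lmeasurable_affine_image[OF lin lmeasurable_unit_simplex]
    by (intro measure_mono_fmeasurable) (auto simp: fmeasurableD)
  then show ?thesis
    by (simp add: measure_affine_image[OF lin lmeasurable_unit_simplex] measure_unit_simplex divide_simps mult.commute)
qed

text \<open>Cramer's rule, for the exchange of one vertex of a simplex.\<close>

lemma det_edge_matrix_replace:
  assumes "b - a = edge_matrix a f *v x"
  shows "det (edge_matrix a (f(k := b))) = x $ k * det (edge_matrix a f)"
proof -
  have "edge_matrix a (f(k := b)) = (\<chi> i j. if j = k then (edge_matrix a f *v x) $ i else edge_matrix a f $ i $ j)"
  proof -
    have "(edge_matrix a f *v x) $ i = b $ i - a $ i" for i by (simp flip: assms)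
    then show ?thesis by (simp add: vec_eq_iff) (simp add: edge_matrix_def)
  qed
  then show ?thesis by (simp only: cramer_lemma)
qed

lemma det_Ints:
  assumes "\<And>i j. A $ i $ j \<in> \<int>"
  shows "det (A :: real ^ 'n ^ 'n) \<in> \<int>"
  unfolding det_def using assms by (intro Ints_sum Ints_mult Ints_prod) auto

text \<open>Otherwise the hull would lie in a proper affine subspace.\<close>

lemma exists_nondegenerate_edges:
  fixes X :: "(real ^ 'n) set"
  assumes "finite X" and pos: "measure lebesgue (convex hull X) \<noteq> 0"
  obtains a f where "a \<in> X" "\<And>j. f j \<in> X" "det (edge_matrix a f) \<noteq> 0"
proof -
  have "X \<noteq> {}" using pos by auto
  then obtain a where a: "a \<in> X" by blast
  have span: "span ((\<lambda>x. x - a) ` X) = UNIV"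
  proof (rule ccontr)
    assume "span ((\<lambda>x. x - a) ` X) \<noteq> UNIV"
    then have "negligible (span ((\<lambda>x. x - a) ` X))"
      by (intro negligible_lowdim) (metis dim_eq_full dim_span dim_subset_UNIV order_le_imp_less_or_eq)
    then have "negligible ((+) a ` span ((\<lambda>x. x - a) ` X))"
      by (rule negligible_translation)
    moreover have "convex hull X \<subseteq> (+) a ` span ((\<lambda>x. x - a) ` X)"
    proof (rule hull_minimal)
      show "X \<subseteq> (+) a ` span ((\<lambda>x. x - a) ` X)"
        by (force intro: image_eqI[of _ _ "x - a" for x] span_base)
      show "convex ((+) a ` span ((\<lambda>x. x - a) ` X))"
        by (intro convex_translation subspace_imp_convex subspace_span)
    qed
    ultimately have "negligible (convex hull X)" by (rule negligible_subset)
    then show False using pos by (simp add: negligible_imp_measure0)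
  qed
  obtain B where B: "B \<subseteq> (\<lambda>x. x - a) ` X" "independent B" "(\<lambda>x. x - a) ` X \<subseteq> span B" "card B = dim ((\<lambda>x. x - a) ` X)"
    using basis_exists by blast
  have "card B = CARD('n)"
    using B(4) span by (metis dim_UNIV dim_span DIM_cart DIM_real mult.right_neutral)
  moreover have "finite B" using B(1) \<open>finite X\<close> finite_subset by blast
  ultimately obtain b where b: "bij_betw b (UNIV :: 'n set) B"
    using finite_same_card_bij[of "UNIV :: 'n set" B] by auto
  define f where "f j = a + b j" for j
  have f: "f j \<in> X" for j
  proof -
    have "b j \<in> (\<lambda>x. x - a) ` X" using B(1) bij_betwE[OF b] by blast
    then show ?thesis by (auto simp: f_def)
  qed
  have "surj ((*v) (edge_matrix a f))"
  proof -
    have "B \<subseteq> range ((*v) (edge_matrix a f))"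
    proof
      fix v assume "v \<in> B"
      then obtain j where "v = b j" using b by (auto simp: bij_betw_def)
      then have "v = edge_matrix a f *v axis j 1" by (simp add: edge_matrix_axis f_def)
      then show "v \<in> range ((*v) (edge_matrix a f))" by blast
    qed
    moreover have "subspace (range ((*v) (edge_matrix a f)))"
      by (intro linear_subspace_image matrix_vector_mul_linear subspace_UNIV)
    ultimately have "span B \<subseteq> range ((*v) (edge_matrix a f))" by (rule span_minimal)
    moreover have "span B = UNIV" using B(3) span span_mono[OF B(3)] by (auto simp: span_span)
    ultimately show ?thesis by auto
  qed
  then have "det (edge_matrix a f) \<noteq> 0"
    by (metis invertible_det_nz invertible_right_inverse matrix_right_invertible_surjective)
  with a f show thesis by (rule that)
qed

lemma lattice_mult_matrix:
  assumes "\<And>i j. A $ i $ j \<in> \<int>" "x \<in> integer_lattice"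
  shows "A *v x \<in> integer_lattice"
  using assms by (auto simp: integer_lattice_def matrix_vector_mult_def intro!: Ints_sum Ints_mult)

lemma lattice_polytope_hull:
  assumes "lattice_polytope P"
  shows "P = convex hull {x. x extreme_point_of P}" "finite {x. x extreme_point_of P}"
    "{x. x extreme_point_of P} \<subseteq> integer_lattice" "compact P" "convex P"
proof -
  show *: "compact P" "convex P" "{x. x extreme_point_of P} \<subseteq> integer_lattice"
    using assms by (auto simp: lattice_polytope_def polytope_imp_compact polytope_imp_convex)
  then show "P = convex hull {x. x extreme_point_of P}" using Krein_Milman_Minkowski by blast
  obtain V where "finite V" "P = convex hull V" using assms by (auto simp: lattice_polytope_def polytope_def)
  then show "finite {x. x extreme_point_of P}"
    using extreme_points_of_convex_hull finite_subset by blast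
qed

text \<open>The frame is a simplex of maximal volume with vertices among those of \<open>P\<close>.\<close>

lemma lattice_polytope_frame:
  fixes P :: "(real ^ 'n) set"
  assumes P: "lattice_polytope P" and V: "measure lebesgue P \<noteq> 0"
  obtains a M C where "P = convex hull ((\<lambda>x. a + M *v x) ` C)" "a \<in> integer_lattice" "\<And>i j. M $ i $ j \<in> \<int>"
    "invertible M" "\<bar>det M\<bar> \<le> fact CARD('n) * measure lebesgue P"
    "\<And>x i. x \<in> C \<Longrightarrow> \<bar>x $ i\<bar> \<le> 1" "\<And>x. x \<in> C \<Longrightarrow> M *v x \<in> integer_lattice"
proof -
  define X where "X = {x. x extreme_point_of P}"
  note X = lattice_polytope_hull[OF P, folded X_def]
  define D :: "(real ^ 'n) \<times> ('n \<Rightarrow> real ^ 'n) \<Rightarrow> real" where "D = (\<lambda>(a, f). \<bar>det (edge_matrix a f)\<bar>)"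
  have fin: "finite (X \<times> ((UNIV :: 'n set) \<rightarrow>\<^sub>E X))"
    using X(2) by (intro finite_cartesian_product finite_PiE) auto
  obtain a0 f0 where 0: "a0 \<in> X" "\<And>j. f0 j \<in> X" "det (edge_matrix a0 f0) \<noteq> 0"
    using exists_nondegenerate_edges[OF X(2)] V X(1) by metis
  have nonempty: "(a0, f0) \<in> X \<times> (UNIV \<rightarrow>\<^sub>E X)" using 0 by auto
  obtain a f where af: "(a, f) \<in> X \<times> (UNIV \<rightarrow>\<^sub>E X)"
    and max: "\<And>y. y \<in> X \<times> (UNIV \<rightarrow>\<^sub>E X) \<Longrightarrow> D y \<le> D (a, f)"
  proof -
    have "Max (D ` (X \<times> (UNIV \<rightarrow>\<^sub>E X))) \<in> D ` (X \<times> (UNIV \<rightarrow>\<^sub>E X))"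
      using fin nonempty by (intro Max_in) auto
    then obtain y where "y \<in> X \<times> (UNIV \<rightarrow>\<^sub>E X)" "D y = Max (D ` (X \<times> (UNIV \<rightarrow>\<^sub>E X)))" by auto
    then show thesis using that[of "fst y" "snd y"] fin by (metis Max_ge finite_imageI imageI prod.collapse)
  qed
  define M where "M = edge_matrix a f"
  have "0 < D (a, f)" using max[OF nonempty] 0(3) by (simp add: D_def)
  then have det: "det M \<noteq> 0" by (simp add: D_def M_def)
  then have inv: "invertible M" by (simp add: invertible_det_nz)
  define C where "C = (\<lambda>x. matrix_inv M *v (x - a)) ` X"
  have Minv: "M *v (matrix_inv M *v y) = y" for y
    using inv by (rule matrix_inv_vector)
  have aX: "a \<in> X" "f j \<in> X" for j using af by auto
  show thesis
  proof (rule that[of a M C])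
    have "(\<lambda>x. a + M *v x) ` C = X" by (simp add: C_def image_image Minv)
    then show "P = convex hull ((\<lambda>x. a + M *v x) ` C)" using X(1) by simp
    show "a \<in> integer_lattice" using aX X(3) by auto
    have Xint: "x $ i \<in> \<int>" if "x \<in> X" for x i using X(3) that by (auto simp: integer_lattice_def)
    show "M $ i $ j \<in> \<int>" for i j using aX Xint by (auto simp: M_def edge_matrix_def)
    show "invertible M" by (fact inv)
    have XP: "X \<subseteq> P" by (auto simp: X_def extreme_point_of_def)
    show "\<bar>det M\<bar> \<le> fact CARD('n) * measure lebesgue P"
      unfolding M_def using X(4,5) XP aX by (intro measure_simplex_le) (auto simp: lmeasurable_compact)
    fix y assume "y \<in> C"
    then obtain x where x: "x \<in> X" "y = matrix_inv M *v (x - a)" by (auto simp: C_def)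
    then have My: "M *v y = x - a" by (simp add: Minv)
    show "M *v y \<in> integer_lattice"
      unfolding My using Xint x(1) aX by (auto simp: integer_lattice_def)
    \<comment> \<open>By maximality, exchanging the vertex \<open>f i\<close> for \<open>x\<close> does not increase the determinant; by Cramer's rule
      the exchange multiplies it by \<open>y $ i\<close>.\<close>
    show "\<bar>y $ i\<bar> \<le> 1" for i
    proof -
      have "D (a, f(i := x)) = \<bar>y $ i\<bar> * D (a, f)"
        using det_edge_matrix_replace[of x a f y i] My by (simp add: D_def M_def abs_mult)
      moreover have "D (a, f(i := x)) \<le> D (a, f)" using aX x(1) by (intro max) auto
      ultimately show ?thesis using \<open>0 < D (a, f)\<close> by simp
    qed
  qed
qed

text \<open>The adjugate matrix is integral; in other words, Cramer's rule again.\<close>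

lemma scaled_inverse_lattice:
  fixes M :: "real ^ 'n ^ 'n"
  assumes M: "\<And>i j. M $ i $ j \<in> \<int>" "invertible M" and x: "M *v x \<in> integer_lattice"
  shows "det M *\<^sub>R x \<in> integer_lattice"
proof -
  have "det M * x $ k \<in> \<int>" for k
  proof -
    have "x $ k * det M = det (\<chi> i j. if j = k then (M *v x) $ i else M $ i $ j)"
      by (rule cramer_lemma[symmetric])
    also have "\<dots> \<in> \<int>"
      using M(1) x by (intro det_Ints) (auto simp: integer_lattice_def)
    finally show ?thesis by (simp add: mult.commute)
  qed
  then show ?thesis by (simp add: integer_lattice_def)
qed

text \<open>The set of all \<open>x\<close> with \<open>M *v x\<close> in the lattice is invariant under integral translations, hence determined by its
  part in the cube \<open>[-1, 1]\<^sup>d\<close>.\<close>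

lemma matrix_lattice_mod_one:
  fixes M M' :: "real ^ 'n ^ 'n"
  assumes M: "\<And>i j. M $ i $ j \<in> \<int>" and M': "\<And>i j. M' $ i $ j \<in> \<int>"
    and eq: "{x. (\<forall>i. \<bar>x $ i\<bar> \<le> 1) \<and> M *v x \<in> integer_lattice}
      = {x. (\<forall>i. \<bar>x $ i\<bar> \<le> 1) \<and> M' *v x \<in> integer_lattice}"
    and x: "M *v x \<in> integer_lattice"
  shows "M' *v x \<in> integer_lattice"
proof -
  define n :: "real ^ 'n" where "n = (\<chi> i. of_int \<lfloor>x $ i\<rfloor>)"
  have n: "n \<in> integer_lattice" by (simp add: n_def integer_lattice_def)
  have add: "u \<in> integer_lattice \<Longrightarrow> v \<in> integer_lattice \<Longrightarrow> u + v \<in> integer_lattice"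
    "u \<in> integer_lattice \<Longrightarrow> v \<in> integer_lattice \<Longrightarrow> u - v \<in> integer_lattice" for u v :: "real ^ 'n"
    by (auto simp: integer_lattice_def)
  have "\<forall>i. \<bar>(x - n) $ i\<bar> \<le> 1"
  proof
    fix i show "\<bar>(x - n) $ i\<bar> \<le> 1"
      by (simp add: n_def abs_le_iff) linarith
  qed
  moreover have "M *v (x - n) \<in> integer_lattice"
    using add(2)[OF x lattice_mult_matrix[OF M n]] by (simp add: matrix_vector_mult_diff_distrib)
  ultimately have "M' *v (x - n) \<in> integer_lattice" using eq by blast
  then show ?thesis
    using add(1)[OF _ lattice_mult_matrix[OF M' n], of "M' *v (x - n)"]
    by (simp add: matrix_vector_mult_diff_distrib)
qed

text \<open>The affine map that carries one frame to the other preserves the lattice precisely when the lattice looks the same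
  in both coordinate systems.\<close>

lemma lattice_equivalent_frames:
  fixes M M' :: "real ^ 'n ^ 'n"
  assumes P: "lattice_polytope P" "P = convex hull ((\<lambda>x. a + M *v x) ` C)" "a \<in> integer_lattice"
      "\<And>i j. M $ i $ j \<in> \<int>" "invertible M"
    and P': "lattice_polytope P'" "P' = convex hull ((\<lambda>x. a' + M' *v x) ` C)" "a' \<in> integer_lattice"
      "\<And>i j. M' $ i $ j \<in> \<int>" "invertible M'"
    and eq: "{x. (\<forall>i. \<bar>x $ i\<bar> \<le> 1) \<and> M *v x \<in> integer_lattice}
      = {x. (\<forall>i. \<bar>x $ i\<bar> \<le> 1) \<and> M' *v x \<in> integer_lattice}"
  shows "(P, P') \<in> lattice_equivalence"
proof -
  have int: "u \<in> integer_lattice \<Longrightarrow> v \<in> integer_lattice \<Longrightarrow> u + v \<in> integer_lattice"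
    "u \<in> integer_lattice \<Longrightarrow> v \<in> integer_lattice \<Longrightarrow> u - v \<in> integer_lattice" for u v :: "real ^ 'n"
    by (auto simp: integer_lattice_def)
  have inv: "matrix_inv M *v (M *v x) = x" "M *v (matrix_inv M *v x) = x"
    "matrix_inv M' *v (M' *v x) = x" "M' *v (matrix_inv M' *v x) = x" for x
    using P(5) P'(5) by (simp_all add: matrix_inv_vector)
  define A where "A = (\<lambda>x. M' *v (matrix_inv M *v x))"
  define T where "T p = A p + (a' - A a)" for p
  have lin: "linear A"
    unfolding A_def by (intro linear_compose[unfolded o_def, of "(*v) (matrix_inv M)" "(*v) M'"] matrix_vector_mul_linear)
  have T: "T p = a' + M' *v (matrix_inv M *v (p - a))" for p
    by (simp add: T_def A_def matrix_vector_mult_diff_distrib)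
  have T_frame: "T (a + M *v x) = a' + M' *v x" for x by (simp add: T inv)
  have coords: "p = a + M *v (matrix_inv M *v (p - a))" "p = a' + M' *v (matrix_inv M' *v (p - a'))" for p
    by (simp_all add: inv)
  have "bij T"
  proof (rule bijI)
    show "inj T"
    proof (rule injI)
      fix p q assume "T p = T q"
      then have "M' *v (matrix_inv M *v (p - a)) = M' *v (matrix_inv M *v (q - a))" by (simp add: T)
      then have "p - a = q - a" by (metis inv)
      then show "p = q" by simp
    qed
    show "surj T"
    proof (rule surjI)
      show "T (a + M *v (matrix_inv M' *v (q - a'))) = q" for q
        unfolding T_frame using coords(2)[of q] by simp
    qed
  qed
  moreover have "T ` integer_lattice = integer_lattice"
  proof (intro equalityI subsetI)
    fix q assume "q \<in> T ` integer_lattice"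
    then obtain p where p: "p \<in> integer_lattice" "q = T p" by blast
    have "M *v (matrix_inv M *v (p - a)) \<in> integer_lattice" using int(2) p(1) P(3) by (simp add: inv)
    then have "M' *v (matrix_inv M *v (p - a)) \<in> integer_lattice"
      by (rule matrix_lattice_mod_one[OF P(4) P'(4) eq])
    then show "q \<in> integer_lattice" unfolding p(2) T using int(1) P'(3) by blast
  next
    fix q :: "real ^ 'n" assume q: "q \<in> integer_lattice"
    define x where "x = matrix_inv M' *v (q - a')"
    have "M' *v x \<in> integer_lattice" using int(2) q P'(3) by (simp add: x_def inv)
    then have "M *v x \<in> integer_lattice"
      by (rule matrix_lattice_mod_one[OF P'(4) P(4) eq[symmetric]])
    then have "a + M *v x \<in> integer_lattice" using int(1) P(3) by blast
    moreover have "T (a + M *v x) = q" unfolding T_frame using coords(2)[of q] by (simp add: x_def)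
    ultimately show "q \<in> T ` integer_lattice" by (metis imageI)
  qed
  ultimately have "lattice_preserving_affine T"
    using lin unfolding lattice_preserving_affine_def T_def by blast
  moreover have "T ` P = P'"
  proof -
    have "T ` (convex hull S) = convex hull (T ` S)" for S
    proof -
      have "T ` U = (+) (a' - A a) ` (A ` U)" for U
        by (simp add: T_def[abs_def] image_image add.commute)
      then show ?thesis
        by (simp only: convex_hull_linear_image[OF lin] convex_hull_translation)
    qed
    then show ?thesis by (simp add: P(2) P'(2) image_image T_frame)
  qed
  ultimately show ?thesis using P(1) P'(1) by (auto simp: lattice_equivalence_def)
qed

text \<open>The class of a polytope is determined by two subsets of the finite set \<open>G\<close> of points in the cube \<open>[-1, 1]\<^sup>d\<close> with a
  common denominator at most \<open>d! V\<close>: the lattice and the vertices in the coordinates of its frame.\<close>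

theorem finite_lattice_polytope_classes:
  assumes "V \<noteq> 0"
  shows "finite ({P :: (real ^ 'n) set. lattice_polytope P \<and> measure lebesgue P = V} // lattice_equivalence)"
proof -
  let ?S = "{P :: (real ^ 'n) set. lattice_polytope P \<and> measure lebesgue P = V}"
  define K where "K = nat \<lfloor>fact CARD('n) * V\<rfloor>"
  define G :: "(real ^ 'n) set" where "G = (\<Union>D\<in>{1..K}. (\<lambda>y. (1 / real D) *\<^sub>R y) ` lattice_cube D)"
  have "finite G" by (simp add: G_def finite_lattice_cube)
  \<comment> \<open>By Cramer's rule the determinant is a common denominator of the coordinates of lattice points.\<close>
  have G: "x \<in> G" if M: "\<And>i j. M $ i $ j \<in> \<int>" "invertible M" "\<bar>det M\<bar> \<le> fact CARD('n) * V"
    and x: "\<And>i. \<bar>x $ i\<bar> \<le> 1" "M *v x \<in> integer_lattice" for M x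
  proof -
    have "det M \<in> \<int>" using M(1) by (rule det_Ints)
    then obtain D' :: int where D': "det M = of_int D'" by (auto elim: Ints_cases)
    define D where "D = nat \<bar>D'\<bar>"
    have "D' \<noteq> 0" using M(2) D' by (auto simp: invertible_det_nz)
    then have D: "1 \<le> D" "real D = \<bar>det M\<bar>" by (auto simp: D_def D')
    have "D \<le> K" using M(3) D(2) by (simp add: K_def le_nat_iff le_floor_iff)
    have "real D *\<^sub>R x \<in> integer_lattice"
      using scaled_inverse_lattice[OF M(1,2) x(2)] D(2)
      by (auto simp: integer_lattice_def abs_if split: if_splits)
    moreover have "\<bar>(real D *\<^sub>R x) $ i\<bar> \<le> real D" for i
      using x(1)[of i] mult_left_mono[of "\<bar>x $ i\<bar>" 1 "real D"] by (simp add: abs_mult)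
    ultimately have "real D *\<^sub>R x \<in> lattice_cube D" by (simp add: lattice_cube_def)
    moreover have "x = (1 / real D) *\<^sub>R (real D *\<^sub>R x)" using D(1) by simp
    ultimately show "x \<in> G"
      using D(1) \<open>D \<le> K\<close> unfolding G_def by (intro UN_I[of D] image_eqI) auto
  qed
  define framed where "framed P F \<longleftrightarrow> (\<exists>(a :: real ^ 'n) (M :: real ^ 'n ^ 'n). P = convex hull ((\<lambda>x. a + M *v x) ` snd F) \<and> a \<in> integer_lattice
      \<and> (\<forall>i j. M $ i $ j \<in> \<int>) \<and> invertible M
      \<and> fst F = {x. (\<forall>i. \<bar>x $ i\<bar> \<le> 1) \<and> M *v x \<in> integer_lattice})" 
    for P :: "(real ^ 'n) set" and F :: "(real ^ 'n) set \<times> (real ^ 'n) set"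
  have "\<exists>F. F \<in> Pow G \<times> Pow G \<and> framed P F" if "P \<in> ?S" for P
  proof -
    have P: "lattice_polytope P" "measure lebesgue P = V" using that by auto
    obtain a M C where *: "P = convex hull ((\<lambda>x. a + M *v x) ` C)" "a \<in> integer_lattice" "\<And>i j. M $ i $ j \<in> \<int>"
      "invertible M" "\<bar>det M\<bar> \<le> fact CARD('n) * V"
      "\<And>x i. x \<in> C \<Longrightarrow> \<bar>x $ i\<bar> \<le> 1" "\<And>x. x \<in> C \<Longrightarrow> M *v x \<in> integer_lattice"
      using lattice_polytope_frame[OF P(1)] P(2) assms by metis
    have "C \<subseteq> G" using G[OF *(3-5) *(6,7)] by blast
    moreover have "{x. (\<forall>i. \<bar>x $ i\<bar> \<le> 1) \<and> M *v x \<in> integer_lattice} \<subseteq> G" using G[OF *(3-5)] by blast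
    ultimately show ?thesis
      using *(1-4) unfolding framed_def by (intro exI[of _ "({x. (\<forall>i. \<bar>x $ i\<bar> \<le> 1) \<and> M *v x \<in> integer_lattice}, C)"]) auto
  qed
  then have "\<forall>P\<in>?S. \<exists>F. F \<in> Pow G \<times> Pow G \<and> framed P F" by blast
  from bchoice[OF this] obtain F where
    F: "\<And>P. P \<in> ?S \<Longrightarrow> F P \<in> Pow G \<times> Pow G" "\<And>P. P \<in> ?S \<Longrightarrow> framed P (F P)"
    by blast
  have same: "lattice_equivalence `` {P} = lattice_equivalence `` {P'}" if PP: "P \<in> ?S" "P' \<in> ?S" "F P = F P'" for P P'
  proof -
    obtain a M where "P = convex hull ((\<lambda>x. a + M *v x) ` snd (F P))" "a \<in> integer_lattice"
      "\<And>i j. M $ i $ j \<in> \<int>" "invertible M"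
      "fst (F P) = {x. (\<forall>i. \<bar>x $ i\<bar> \<le> 1) \<and> M *v x \<in> integer_lattice}"
      using F(2)[OF PP(1)] unfolding framed_def by blast
    moreover obtain a' M' where "P' = convex hull ((\<lambda>x. a' + M' *v x) ` snd (F P))" "a' \<in> integer_lattice"
      "\<And>i j. M' $ i $ j \<in> \<int>" "invertible M'"
      "fst (F P) = {x. (\<forall>i. \<bar>x $ i\<bar> \<le> 1) \<and> M' *v x \<in> integer_lattice}"
      using F(2)[OF PP(2)] unfolding PP(3) framed_def by blast
    moreover have "lattice_polytope P" "lattice_polytope P'" using PP by auto
    ultimately have "(P, P') \<in> lattice_equivalence"
      by (intro lattice_equivalent_frames[of P a M "snd (F P)" P' a' M']) auto
    then show ?thesis by (rule equiv_class_eq[OF equiv_lattice_equivalence])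
  qed
  have "?S // lattice_equivalence \<subseteq> (\<lambda>v. lattice_equivalence `` {inv_into ?S F v}) ` (Pow G \<times> Pow G)"
  proof
    fix c assume "c \<in> ?S // lattice_equivalence"
    then obtain P where P: "P \<in> ?S" "c = lattice_equivalence `` {P}" by (auto elim: quotientE)
    have "c = lattice_equivalence `` {inv_into ?S F (F P)}"
    proof -
      have FP: "F P \<in> F ` ?S" using P(1) by (rule imageI)
      show ?thesis
        unfolding P(2) by (rule same[OF P(1) inv_into_into[OF FP] f_inv_into_f[OF FP, symmetric]])
    qed
    then show "c \<in> (\<lambda>v. lattice_equivalence `` {inv_into ?S F v}) ` (Pow G \<times> Pow G)"
      using F(1)[OF P(1)] by (rule image_eqI)
  qed
  then show ?thesis
    by (rule finite_subset) (use \<open>finite G\<close> in simp)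
qed

section \<open>Counting classes in a bounded family\<close>

text \<open>Fix a member \<open>R\<close> of a class. Any other member is the image of \<open>R\<close> under an affine map, and such a map is determined
  by the images of \<open>w\<close> and of the points \<open>w + e\<^sub>i\<close>, which are lattice points of the cube.\<close>

lemma card_family_le_num_lattice_polytopes:
  fixes \<F> :: "(real ^ 'n) set set"
  assumes V: "V \<noteq> 0" and fin: "finite \<F>"
    and lat: "\<And>P. P \<in> \<F> \<Longrightarrow> lattice_polytope P \<and> measure lebesgue P = V"
    and cube: "\<And>P x i. P \<in> \<F> \<Longrightarrow> x \<in> P \<Longrightarrow> \<bar>x $ i\<bar> \<le> real N"
    and w: "w \<in> integer_lattice"
    and frame: "\<And>P. P \<in> \<F> \<Longrightarrow> w \<in> P" "\<And>P i. P \<in> \<F> \<Longrightarrow> w + axis i 1 \<in> P"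
  shows "card \<F> \<le> num_lattice_polytopes TYPE('n) V * (2 * N + 1) ^ (CARD('n) * (CARD('n) + 1))"
proof -
  let ?S = "{P :: (real ^ 'n) set. lattice_polytope P \<and> measure lebesgue P = V}"
  let ?cls = "\<lambda>P. lattice_equivalence `` {P :: (real ^ 'n) set}"
  let ?q = "(2 * N + 1) ^ CARD('n)"
  let ?cube = "lattice_cube N :: (real ^ 'n) set"
  have fibre: "card {P \<in> \<F>. ?cls P = ?cls R} \<le> ?q ^ (CARD('n) + 1)" if R: "R \<in> \<F>" for R
  proof -
    \<comment> \<open>The image of \<open>R\<close> under the affine map that sends \<open>w\<close> to \<open>b\<close> and \<open>w + e\<^sub>i\<close> to \<open>g i\<close>.\<close>
    define \<Psi> :: "(real ^ 'n) \<times> ('n \<Rightarrow> real ^ 'n) \<Rightarrow> (real ^ 'n) set" where "\<Psi> = (\<lambda>(b, g). (\<lambda>p. b + (\<Sum>i\<in>UNIV. (p - w) $ i *\<^sub>R (g i - b))) ` R)"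
    have "{P \<in> \<F>. ?cls P = ?cls R} \<subseteq> \<Psi> ` (?cube \<times> (UNIV \<rightarrow>\<^sub>E ?cube))"
    proof
      fix P assume "P \<in> {P \<in> \<F>. ?cls P = ?cls R}"
      then have P: "P \<in> \<F>" "?cls P = ?cls R" by auto
      have "(R, P) \<in> lattice_equivalence"
        using eq_equiv_class[OF P(2)[symmetric] equiv_lattice_equivalence] lat[OF P(1)] by simp
      then obtain T where T: "lattice_preserving_affine T" "T ` R = P"
        by (auto simp: lattice_equivalence_def)
      obtain A b where A: "linear A" "T = (\<lambda>x. A x + b)"
        using T(1) by (auto simp: lattice_preserving_affine_def)
      have mem: "T x \<in> ?cube" if "x \<in> R" "x \<in> integer_lattice" for x
      proof -
        have "T x \<in> integer_lattice" "T x \<in> P"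
          using that T by (auto simp: lattice_preserving_affine_def)
        then show ?thesis using cube[OF P(1)] by (simp add: lattice_cube_def)
      qed
      have "w + axis i 1 \<in> integer_lattice" for i
        using w by (auto simp: integer_lattice_def axis_def)
      then have "(T w, \<lambda>i. T (w + axis i 1)) \<in> ?cube \<times> (UNIV \<rightarrow>\<^sub>E ?cube)"
        using mem frame[OF R] w by auto
      moreover have T_frame: "T p = T w + (\<Sum>i\<in>UNIV. (p - w) $ i *\<^sub>R (T (w + axis i 1) - T w))" for p
      proof -
        have "A (p - w) = A (\<Sum>i\<in>UNIV. (p - w) $ i *\<^sub>R axis i 1)"
          using basis_expansion[of "p - w"] by (simp add: scalar_mult_eq_scaleR)
        also have "\<dots> = (\<Sum>i\<in>UNIV. (p - w) $ i *\<^sub>R A (axis i 1))"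
          by (simp add: linear_sum[OF A(1)] linear_scale[OF A(1)])
        finally show ?thesis
          using linear_diff[OF A(1), of p w] by (simp add: A(2) linear_add[OF A(1)] diff_eq_eq add.commute)
      qed
      have "P = \<Psi> (T w, \<lambda>i. T (w + axis i 1))"
        unfolding \<Psi>_def prod.case T(2)[symmetric] by (rule image_cong[OF refl T_frame])
      ultimately show "P \<in> \<Psi> ` (?cube \<times> (UNIV \<rightarrow>\<^sub>E ?cube))" by blast
    qed
    then have "card {P \<in> \<F>. ?cls P = ?cls R} \<le> card (\<Psi> ` (?cube \<times> ((UNIV :: 'n set) \<rightarrow>\<^sub>E ?cube)))"
      by (intro card_mono finite_imageI finite_cartesian_product finite_PiE finite_lattice_cube) auto
    also have "\<dots> \<le> card (?cube \<times> ((UNIV :: 'n set) \<rightarrow>\<^sub>E ?cube))"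
      by (intro card_image_le finite_cartesian_product finite_PiE finite_lattice_cube) auto
    also have "\<dots> = card ?cube ^ (CARD('n) + 1)"
      by (simp add: card_cartesian_product card_PiE)
    also have "\<dots> \<le> ?q ^ (CARD('n) + 1)"
      by (intro power_mono card_lattice_cube_le) auto
    finally show ?thesis .
  qed
  have "card \<F> = card (\<Union>c\<in>?cls ` \<F>. {P \<in> \<F>. ?cls P = c})"
    by (rule arg_cong[of _ _ card]) auto
  also have "\<dots> \<le> (\<Sum>c\<in>?cls ` \<F>. card {P \<in> \<F>. ?cls P = c})"
    using fin by (intro card_UN_le finite_imageI)
  also have "\<dots> \<le> (\<Sum>c\<in>?cls ` \<F>. ?q ^ (CARD('n) + 1))"
    using fibre by (intro sum_mono) auto
  also have "\<dots> = card (?cls ` \<F>) * ?q ^ (CARD('n) + 1)" by simp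
  also have "\<dots> \<le> card (?S // lattice_equivalence) * ?q ^ (CARD('n) + 1)"
    using lat by (intro mult_right_mono card_mono finite_lattice_polytope_classes V) (auto intro!: quotientI)
  also have "\<dots> = num_lattice_polytopes TYPE('n) V * (2 * N + 1) ^ (CARD('n) * (CARD('n) + 1))"
    by (simp only: num_lattice_polytopes_def power_mult)
  finally show ?thesis .
qed

section \<open>The lower bound\<close>

lemma digit_expansion:
  fixes r m :: nat
  shows "(\<Sum>j<n. (r div m ^ j) mod m * m ^ j) + (r div m ^ n) * m ^ n = r"
proof (induction n)
  case (Suc n)
  have "r div m ^ n = (r div m ^ n) mod m + m * (r div m ^ Suc n)"
    by (metis div_mult2_eq mod_mult_div_eq power_Suc2)
  then have "(r div m ^ n) * m ^ n = ((r div m ^ n) mod m + m * (r div m ^ Suc n)) * m ^ n"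
    by (rule arg_cong)
  also have "\<dots> = (r div m ^ n) mod m * m ^ n + (r div m ^ Suc n) * m ^ Suc n"
    by (simp add: algebra_simps)
  finally have "(r div m ^ n) * m ^ n = (r div m ^ n) mod m * m ^ n + (r div m ^ Suc n) * m ^ Suc n" .
  with Suc show ?case by simp
qed simp

text \<open>The points \<open>axis k Y\<close> and \<open>axis k Y + e\<^sub>i\<close> lie between the dents and the trimmed corners, hence in all the
  polytopes; they serve to bound the number of equivalences.\<close>

lemma dented_polytope_of_volume:
  fixes k :: "'n::finite" and pos :: "'n \<Rightarrow> nat" and m D :: nat
  defines "d \<equiv> CARD('n)" and "Y \<equiv> chord_height TYPE('n) (4 * m)" and "K \<equiv> fact CARD('n) * (4 * m) ^ (CARD('n) - 1)"
  assumes d2: "2 \<le> CARD('n)" and m: "1 \<le> m"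
    and D: "K * (Y + fact CARD('n) * 4 ^ (CARD('n) - 1) + m + 1) \<le> D"
    and pos: "bij_betw pos UNIV {..<CARD('n)}" "pos k = CARD('n) - 1"
    and T: "T \<subseteq> dent_grid k m"
  shows "\<exists>Q :: (real ^ 'n) set. lattice_polytope Q \<and> measure lebesgue Q = real D / fact CARD('n)
    \<and> (\<forall>x\<in>Q. \<forall>i. \<bar>x $ i\<bar> \<le> real (3 * D + 1))
    \<and> axis k (real Y) \<in> Q \<and> (\<forall>i. axis k (real Y) + axis i 1 \<in> Q)
    \<and> (\<forall>z\<in>dent_grid k m. tip k z \<in> Q \<longleftrightarrow> z \<notin> T)"
proof -
  define L where "L = 4 * m"
  define S :: nat where "S = fact d * 4 ^ (d - 1) + m"
  have d: "2 \<le> d" "d = Suc (d - 1)" using d2 by (auto simp: d_def)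
  have K: "K = fact d * L ^ (d - 1)" by (simp add: K_def d_def L_def)
  have L1: "1 \<le> L" using m by (simp add: L_def)
  have K1: "L ^ (d - 1) \<le> K" "1 \<le> K"
    using L1 by (auto simp: K fact_ge_1)
  have KD: "K * (Y + S + 1) \<le> D" using D by (simp add: S_def d_def add.assoc)
  have "K * 1 \<le> D" "K * Y \<le> D" using KD by (auto intro: order_trans[OF mult_le_mono2 KD])
  then have KD': "K \<le> D" "K * Y \<le> D" by auto
  obtain w :: int where w: "0 \<le> w" "w \<le> fact CARD('n) * int L ^ (CARD('n) - 1) * int (chord_height TYPE('n) L)"
    and vol: "\<And>H. real (chord_height TYPE('n) L) \<le> H \<Longrightarrow>
      fact CARD('n) * measure lebesgue (chord_region k L H :: (real ^ 'n) set)
        = fact CARD('n) * real L ^ (CARD('n) - 1) * H - of_int w"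
    using chord_region_volume[OF d2 L1] by blast
  have YL: "chord_height TYPE('n) L = Y" by (simp add: Y_def L_def)
  have "w \<le> int (K * Y)" using w(2) by (simp add: YL K d_def)
  then have w': "nat w \<le> K * Y" by linarith
  \<comment> \<open>The height \<open>H\<close> fixes the volume up to a remainder \<open>r \<le> K\<close>, which the trimmed corners remove.\<close>
  define X where "X = D + nat w + 2 ^ (d - 1) * card T"
  define H where "H = X div K + 1"
  define r where "r = K * H - X"
  have XH: "X \<le> K * H" "r \<le> K"
  proof -
    have "K * (X div K) + X mod K = X" by simp
    moreover have "X mod K < K" using K1 by simp
    moreover have "K * H = K * (X div K) + K" by (simp add: H_def)
    ultimately show "X \<le> K * H" "r \<le> K" unfolding r_def by linarith+
  qed
  have H: "Y + S + 1 \<le> H"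
  proof -
    have "K * (Y + S + 1) \<le> X" using KD by (simp add: X_def)
    then have "Y + S + 1 \<le> X div K"
      using K1 by (simp add: less_eq_div_iff_mult_less_eq mult.commute)
    then show ?thesis by (simp add: H_def)
  qed
  \<comment> \<open>Digits in base \<open>m\<close>, except that the leading one is not reduced; it is at most \<open>d! 4\<^sup>d\<^sup>-\<^sup>1\<close>.\<close>
  define s where "s a = (if a < d - 1 then (r div m ^ a) mod m else r div m ^ a)" for a
  define t where "t j = s (pos j)" for j
  have sum_t: "(\<Sum>j\<in>UNIV. t j * m ^ pos j) = r"
  proof -
    have "(\<Sum>j\<in>UNIV. t j * m ^ pos j) = (\<Sum>a<d. s a * m ^ a)"
      unfolding t_def using sum.reindex_bij_betw[OF pos(1), of "\<lambda>a. s a * m ^ a"] by (simp add: d_def)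
    also have "\<dots> = (\<Sum>a<d - 1. s a * m ^ a) + s (d - 1) * m ^ (d - 1)"
      by (subst d(2)) simp
    also have "\<dots> = (\<Sum>a<d - 1. (r div m ^ a) mod m * m ^ a) + (r div m ^ (d - 1)) * m ^ (d - 1)"
      by (simp add: s_def)
    also have "\<dots> = r" by (rule digit_expansion)
    finally show ?thesis .
  qed
  have t: "t j \<le> S" for j
  proof (cases "pos j < d - 1")
    case True
    then have "t j < m" using m by (simp add: t_def s_def)
    then show ?thesis by (simp add: S_def)
  next
    case False
    moreover have "pos j < d" using bij_betwE[OF pos(1)] by (auto simp: d_def)
    ultimately have "pos j = d - 1" by linarith
    then have "t j = r div m ^ (d - 1)" by (simp add: t_def s_def)
    also have "\<dots> \<le> K div m ^ (d - 1)" using XH(2) by (rule div_le_mono)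
    also have "\<dots> = fact d * 4 ^ (d - 1)" using m by (simp add: K L_def power_mult_distrib)
    finally show ?thesis by (simp add: S_def)
  qed
  have T_grid: "z \<in> dent_grid k m" if "z \<in> T" for z using T that by blast
  have finT: "finite T" using T dent_grid_properties(1) finite_subset by blast
  have height: "real (chord_height TYPE('n) L) \<le> real H" using H by (simp add: YL)
  let ?B = "dented_region k L (real H) T :: (real ^ 'n) set"
  have B: "lattice_polytope ?B"
    "fact CARD('n) * measure lebesgue ?B
      = fact CARD('n) * measure lebesgue (chord_region k L (real H) :: (real ^ 'n) set) - 2 ^ (CARD('n) - 1) * real (card T)"
    using dent_grid_properties(3,4)[of _ k m] T_grid height
    by (intro lattice_polytope_dented_region[OF finT]; simp add: L_def)+
  have B_reg: "(\<forall>i\<in>-{k}. 0 \<le> p $ i \<and> p $ i \<le> real L) \<and> 0 \<le> p $ k \<and> p $ k \<le> real H" if "p \<in> ?B" for p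
  proof -
    have p: "p \<in> chord_region k L (real H)" using that by (simp add: dented_region_def)
    have "0 \<le> chord_square (p $ i)" for i using chord_square_bounds(1)[of "p $ i"] by (meson order_trans zero_le_power2)
    then have "0 \<le> (\<Sum>i\<in>-{k}. chord_square (p $ i))" by (rule sum_nonneg)
    with p show ?thesis by (auto simp: chord_region_def)
  qed
  have below: "(\<forall>i\<in>-{k}. 0 \<le> p $ i \<and> p $ i \<le> real L) \<and> p $ k \<le> real H" if "p \<in> ?B" for p
    using B_reg[OF that] by simp
  have top: "p \<in> ?B" if "\<forall>i\<in>-{k}. 0 \<le> p $ i \<and> p $ i \<le> real L" "real (Y + 1) \<le> p $ k" "p $ k \<le> real H" for p
    using that by (intro mem_dented_region_top) (auto simp: YL)
  have mL: "2 * m \<le> L" by (simp add: L_def)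
  have room: "real (t j) \<le> real H - real (Y + 1)" for j using t[of j] H by linarith
  obtain Q where Q: "lattice_polytope Q" "Q \<subseteq> ?B" "\<And>p. p \<in> ?B \<Longrightarrow> p $ k \<le> real (Y + 1) \<Longrightarrow> p \<in> Q"
    "fact CARD('n) * measure lebesgue Q = fact CARD('n) * measure lebesgue ?B - (\<Sum>j\<in>UNIV. real (t j * m ^ pos j))"
    by (rule trim_corners[where t = t, OF B(1) below top m mL Ints_of_nat room pos], assumption+, rule that)
  show ?thesis
  proof (intro exI[of _ Q] conjI ballI allI)
    show "lattice_polytope Q" by (fact Q(1))
    have "fact CARD('n) * measure lebesgue Q = real K * real H - real (nat w) - 2 ^ (d - 1) * real (card T) - real r"
      using Q(4)[unfolded of_nat_sum[symmetric] sum_t] B(2) vol[OF height] w(1) by (simp add: K d_def)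
    also have "real r = real K * real H - real X" using XH(1) by (simp add: r_def of_nat_diff)
    finally have "fact CARD('n) * measure lebesgue Q = real D" by (simp add: X_def)
    then show "measure lebesgue Q = real D / fact CARD('n)" by (simp add: field_simps)
  next
    fix x i assume "x \<in> Q"
    then have x: "x \<in> ?B" using Q(2) by blast
    have "2 ^ (d - 1) * card T \<le> 2 ^ (d - 1) * m ^ (d - 1)"
      using card_mono[OF dent_grid_properties(1) T] by (simp add: dent_grid_properties(2) d_def)
    also have "\<dots> = (2 * m) ^ (d - 1)" by (simp only: power_mult_distrib)
    also have "\<dots> \<le> L ^ (d - 1)" by (rule power_mono) (auto simp: L_def)
    finally have "X \<le> 3 * D" using K1(1) KD' w' by (simp add: X_def)
    moreover have "X div K \<le> X" by (rule div_le_dividend)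
    ultimately have "H \<le> 3 * D + 1" unfolding H_def by linarith
    moreover have "L \<le> 3 * D + 1"
    proof -
      have "L \<le> L ^ (d - 1)" using L1 d by (intro self_le_power) auto
      then show ?thesis using K1(1) KD'(1) by linarith
    qed
    ultimately have "real H \<le> real (3 * D + 1)" "real L \<le> real (3 * D + 1)" by (simp_all only: of_nat_le_iff)
    then show "\<bar>x $ i\<bar> \<le> real (3 * D + 1)"
      using B_reg[OF x] by (cases "i = k") force+
  next
    have top: "p \<in> Q" if "\<forall>i\<in>-{k}. 0 \<le> p $ i \<and> p $ i \<le> real L" "real Y \<le> p $ k" "p $ k \<le> real (Y + 1)" for p
    proof (rule Q(3)[OF mem_dented_region_top])
      show "p $ k \<le> real H" using that(3) H by linarith
    qed (use that in \<open>auto simp: YL\<close>)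
    show "axis k (real Y) \<in> Q" by (rule top) (auto simp: axis_def)
    show "axis k (real Y) + axis i 1 \<in> Q" for i
      using L1 by (intro top) (auto simp: axis_def)
  next
    fix z assume z: "z \<in> dent_grid k m"
    have z_bd: "\<And>i. i \<in> -{k} \<Longrightarrow> 1 \<le> z i \<and> z i < int L" using dent_grid_properties(3)[OF z] by (simp add: L_def)
    have sep: "2 \<le> (\<Sum>i\<in>-{k}. \<bar>z i - z' i\<bar>)" if "z' \<in> T" "z \<noteq> z'" for z'
      using dent_grid_properties(4)[OF z T_grid] that by blast
    have tip: "tip k z \<in> chord_region k L (real H)" "tip k z \<in> ?B \<longleftrightarrow> z \<notin> T"
      by (rule tip_mem_dented_region_iff[where T = T]; fact z_bd height sep)+
    have "tip k z $ k \<le> real (Y + 1)"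
    proof -
      have box: "\<forall>i\<in>-{k}. 0 \<le> tip k z $ i \<and> tip k z $ i \<le> real L"
        using tip(1) unfolding chord_region_def by blast
      have "tip k z $ k = (\<Sum>i\<in>-{k}. (tip k z $ i)\<^sup>2)"
        by (simp add: tip_def)
      also have "\<dots> \<le> (\<Sum>i\<in>-{k}. chord_square (tip k z $ i))"
        by (intro sum_mono chord_square_bounds)
      finally show ?thesis using sum_chord_square_le_height[OF box] by (simp add: YL)
    qed
    then show "tip k z \<in> Q \<longleftrightarrow> z \<notin> T"
      using tip(2) Q(2,3) by blast
  qed
qed

lemma many_lattice_polytopes:
  assumes d2: "2 \<le> CARD('n::finite)" and m: "1 \<le> m"
    and D: "fact CARD('n) * (4 * m) ^ (CARD('n) - 1) *
      (chord_height TYPE('n) (4 * m) + fact CARD('n) * 4 ^ (CARD('n) - 1) + m + 1) \<le> D"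
  shows "2 ^ (m ^ (CARD('n) - 1)) \<le> num_lattice_polytopes TYPE('n) (real D / fact CARD('n))
    * (6 * D + 3) ^ (CARD('n) * (CARD('n) + 1))"
proof -
  obtain pos :: "'n \<Rightarrow> nat" where pos: "bij_betw pos UNIV {..<CARD('n)}"
    using ex_bij_betw_finite_nat[of "UNIV :: 'n set"] by (auto simp: atLeast0LessThan)
  have "CARD('n) - 1 \<in> pos ` UNIV" using pos by (simp add: bij_betw_def)
  then obtain k where k: "pos k = CARD('n) - 1" by auto
  define G where "G = dent_grid k m"
  define Y where "Y = chord_height TYPE('n) (4 * m)"
  define good where "good T Q \<longleftrightarrow> lattice_polytope Q \<and> measure lebesgue Q = real D / fact CARD('n)
    \<and> (\<forall>x\<in>Q. \<forall>i. \<bar>x $ i\<bar> \<le> real (3 * D + 1))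
    \<and> axis k (real Y) \<in> Q \<and> (\<forall>i. axis k (real Y) + axis i 1 \<in> Q)
    \<and> (\<forall>z\<in>G. tip k z \<in> Q \<longleftrightarrow> z \<notin> T)" for T and Q :: "(real ^ 'n) set"
  have "\<forall>T\<in>Pow G. \<exists>Q. good T Q"
    unfolding good_def G_def Y_def using dented_polytope_of_volume[OF d2 m D pos k] by blast
  from bchoice[OF this] obtain Q where Q: "\<And>T. T \<in> Pow G \<Longrightarrow> good T (Q T)" by blast
  \<comment> \<open>The set \<open>T\<close> is recovered from the polytope as the set of missing tips.\<close>
  have inj: "inj_on Q (Pow G)"
  proof (rule inj_onI)
    fix T T' assume *: "T \<in> Pow G" "T' \<in> Pow G" "Q T = Q T'"
    have T_eq: "T = {z \<in> G. tip k z \<notin> Q T}" if "T \<in> Pow G" for T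
      using Q[OF that] that by (auto simp: good_def)
    show "T = T'" using T_eq[OF *(1)] T_eq[OF *(2)] *(3) by simp
  qed
  have "1 \<le> D"
  proof -
    have "0 < fact CARD('n) * (4 * m) ^ (CARD('n) - 1) *
      (chord_height TYPE('n) (4 * m) + fact CARD('n) * 4 ^ (CARD('n) - 1) + m + 1)"
      using m by simp
    with D show ?thesis by linarith
  qed
  have "card (Q ` Pow G) \<le> num_lattice_polytopes TYPE('n) (real D / fact CARD('n))
      * (2 * (3 * D + 1) + 1) ^ (CARD('n) * (CARD('n) + 1))"
  proof (rule card_family_le_num_lattice_polytopes[where w = "axis k (real Y)"])
    show "real D / fact CARD('n) \<noteq> 0" using \<open>1 \<le> D\<close> by simp
    show "finite (Q ` Pow G)" by (simp add: G_def dent_grid_properties(1))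
    show "axis k (real Y) \<in> integer_lattice" by (simp add: integer_lattice_def axis_def)
  qed (use Q in \<open>auto simp: good_def\<close>)
  moreover have "card (Q ` Pow G) = 2 ^ (m ^ (CARD('n) - 1))"
    using inj by (simp add: card_image card_Pow G_def dent_grid_properties(1,2))
  moreover have "2 * (3 * D + 1) + 1 = 6 * D + 3" by simp
  ultimately show ?thesis by (simp only:)
qed


lemma log_le_powr_eventually:
  fixes \<alpha> \<epsilon> B :: real
  assumes "0 < \<alpha>" "0 < \<epsilon>"
  shows "\<forall>\<^sub>F x in at_top. B * ln (6 * x + 3) \<le> \<epsilon> * x powr \<alpha>"
  using assms by real_asymp

text \<open>The volume needed by the construction is of order \<open>m\<^sup>d\<^sup>+\<^sup>1\<close>.\<close>

lemma many_lattice_polytopes_size: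
  fixes d m :: nat
  assumes "1 \<le> d" "1 \<le> m"
  shows "fact d * (4 * m) ^ (d - 1) * (d * ((4 * m)\<^sup>2 + 1) + fact d * 4 ^ (d - 1) + m + 1)
    \<le> fact d * 4 ^ (d - 1) * (17 * d + fact d * 4 ^ (d - 1) + 2) * m ^ (d + 1)"
proof -
  have m2: "1 \<le> m\<^sup>2" "m \<le> m\<^sup>2" using assms by (simp_all add: power2_eq_square)
  have "(4 * m)\<^sup>2 + 1 \<le> 17 * m\<^sup>2" using m2 by (simp add: power_mult_distrib)
  then have "d * ((4 * m)\<^sup>2 + 1) \<le> d * (17 * m\<^sup>2)" by (rule mult_le_mono2)
  moreover have "fact d * 4 ^ (d - 1) * 1 \<le> fact d * 4 ^ (d - 1) * m\<^sup>2"
    using m2 by (intro mult_le_mono2)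
  ultimately have "d * ((4 * m)\<^sup>2 + 1) + fact d * 4 ^ (d - 1) + m + 1
      \<le> d * (17 * m\<^sup>2) + fact d * 4 ^ (d - 1) * m\<^sup>2 + 2 * m\<^sup>2"
    using m2 by linarith
  also have "\<dots> = (17 * d + fact d * 4 ^ (d - 1) + 2) * m\<^sup>2"
    by (simp add: distrib_right)
  finally have "fact d * (4 * m) ^ (d - 1) * (d * ((4 * m)\<^sup>2 + 1) + fact d * 4 ^ (d - 1) + m + 1)
      \<le> fact d * (4 * m) ^ (d - 1) * ((17 * d + fact d * 4 ^ (d - 1) + 2) * m\<^sup>2)"
    by (rule mult_le_mono2)
  also have "\<dots> = fact d * 4 ^ (d - 1) * (17 * d + fact d * 4 ^ (d - 1) + 2) * (m ^ (d - 1) * m\<^sup>2)"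
    by (simp only: power_mult_distrib ac_simps)
  also have "m ^ (d - 1) * m\<^sup>2 = m ^ (d + 1)"
    using assms by (simp flip: power_add)
  finally show ?thesis .
qed

theorem corollary2p1:
  assumes "CARD('n::finite) \<ge> 2"
  shows "\<exists>V\<^sub>0 > (0::real). \<exists>c > (0::real). \<forall>V :: real. V > V\<^sub>0 \<longrightarrow> fact CARD('n) * V \<in> \<int> \<longrightarrow>
    V powr ((real CARD('n) - 1) / (real CARD('n) + 1)) \<le> c * ln (real (num_lattice_polytopes TYPE('n) V))"
proof -
  define d where "d = CARD('n)"
  define \<alpha> where "\<alpha> = (real d - 1) / (real d + 1)"
  define A :: nat where "A = fact d * 4 ^ (d - 1) * (17 * d + fact d * 4 ^ (d - 1) + 2)"
  define \<gamma> where "\<gamma> = ln 2 / 2 ^ (d - 1) / real A powr \<alpha>"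
  have d: "2 \<le> d" using assms by (simp add: d_def)
  have \<alpha>: "0 < \<alpha>" using d by (simp add: \<alpha>_def)
  have "0 < A" by (simp add: A_def)
  then have A: "1 \<le> A" by simp
  then have \<gamma>: "0 < \<gamma>" by (simp add: \<gamma>_def)
  have "\<forall>\<^sub>F x in at_top. real (d * (d + 1)) * ln (6 * x + 3) \<le> \<gamma> / 2 * x powr \<alpha>"
    using \<alpha> \<gamma> by (intro log_le_powr_eventually) auto
  then obtain x0 where x0: "\<And>x. x0 \<le> x \<Longrightarrow> real (d * (d + 1)) * ln (6 * x + 3) \<le> \<gamma> / 2 * x powr \<alpha>"
    by (auto simp: eventually_at_top_linorder)
  have main: "V powr \<alpha> \<le> 2 / \<gamma> * ln (real (num_lattice_polytopes TYPE('n) V))"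
    if V: "max (real A) x0 < V" and int: "fact d * V \<in> \<int>" for V
  proof -
    have V0: "0 < V" using V A by linarith
    obtain D' :: int where D': "fact d * V = of_int D'" using int by (auto elim: Ints_cases)
    have "0 < fact d * V" using V0 by simp
    define D where "D = nat D'"
    have D: "real D = fact d * V" using D' \<open>0 < fact d * V\<close> by (simp add: D_def)
    have VD: "V \<le> real D"
      using mult_right_mono[OF fact_ge_1[of d, where 'a = real], of V] V0 D by simp
    \<comment> \<open>The largest admissible grid size is \<open>m = \<lfloor>y\<rfloor>\<close>, since the construction needs \<open>A m\<^sup>d\<^sup>+\<^sup>1 \<le> D\<close>.\<close>
    define y where "y = (real D / real A) powr (1 / (real d + 1))"
    have "1 \<le> real D / real A" using V VD A by (simp add: divide_simps)
    then have y1: "1 \<le> y" unfolding y_def by (intro ge_one_powr_ge_zero) auto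
    have y_pow: "y ^ (d + 1) = real D / real A"
    proof -
      have "y ^ (d + 1) = y powr (real d + 1)" using y1 by (subst powr_realpow[symmetric]) (auto simp: add.commute)
      also have "\<dots> = real D / real A"
        using \<open>1 \<le> real D / real A\<close> by (simp add: y_def powr_powr)
      finally show ?thesis .
    qed
    define m where "m = nat \<lfloor>y\<rfloor>"
    have "1 \<le> \<lfloor>y\<rfloor>" using y1 by simp
    then have "1 \<le> m" "real m = of_int \<lfloor>y\<rfloor>" unfolding m_def by linarith+
    moreover have "of_int \<lfloor>y\<rfloor> \<le> y" "y < of_int \<lfloor>y\<rfloor> + 1" by simp_all
    ultimately have m: "1 \<le> m" "real m \<le> y" "y / 2 \<le> real m" by linarith+
    have "real (A * m ^ (d + 1)) \<le> real A * y ^ (d + 1)"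
      using m(2) by (simp add: mult_left_mono power_mono del: power_Suc)
    also have "\<dots> = real D" using y_pow A by simp
    finally have "A * m ^ (d + 1) \<le> D" by (simp only: of_nat_le_iff)
    then have size: "fact d * (4 * m) ^ (d - 1) * (d * ((4 * m)\<^sup>2 + 1) + fact d * 4 ^ (d - 1) + m + 1) \<le> D"
      using many_lattice_polytopes_size[of d m] d m(1) unfolding A_def by linarith
    let ?N = "num_lattice_polytopes TYPE('n) V"
    have "real D / fact d = V" by (simp add: D)
    then have count: "2 ^ (m ^ (d - 1)) \<le> ?N * (6 * D + 3) ^ (d * (d + 1))"
      using many_lattice_polytopes[OF assms m(1), of D] size by (simp add: chord_height_def d_def)
    then have N: "1 \<le> ?N" by (cases "?N = 0") auto
    have "real m ^ (d - 1) * ln 2 = ln (2 ^ (m ^ (d - 1)))" by (simp add: ln_realpow)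
    also have "\<dots> \<le> ln (real (?N * (6 * D + 3) ^ (d * (d + 1))))"
    proof (rule ln_mono)
      have "real (2 ^ (m ^ (d - 1))) \<le> real (?N * (6 * D + 3) ^ (d * (d + 1)))"
        using count by (simp only: of_nat_le_iff)
      then show "2 ^ (m ^ (d - 1)) \<le> real (?N * (6 * D + 3) ^ (d * (d + 1)))" by simp
    qed auto
    also have "\<dots> = ln (real ?N) + real (d * (d + 1)) * ln (6 * real D + 3)"
      using N by (simp add: ln_mult ln_realpow)
    also have "\<dots> \<le> ln (real ?N) + \<gamma> / 2 * real D powr \<alpha>"
      using x0[of "real D"] V VD by simp
    finally have upper: "real m ^ (d - 1) * ln 2 \<le> ln (real ?N) + \<gamma> / 2 * real D powr \<alpha>" .
    have "\<gamma> * real D powr \<alpha> = (y / 2) ^ (d - 1) * ln 2"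
    proof -
      have "y ^ (d - 1) = y powr (real d - 1)"
        using y1 d by (subst powr_realpow[symmetric]) (auto simp: of_nat_diff)
      also have "\<dots> = (real D / real A) powr \<alpha>"
        by (simp add: y_def powr_powr \<alpha>_def)
      also have "\<dots> = real D powr \<alpha> / real A powr \<alpha>"
        by (simp add: powr_divide)
      finally show ?thesis by (simp add: \<gamma>_def power_divide mult.commute)
    qed
    also have "\<dots> \<le> real m ^ (d - 1) * ln 2"
      using m(3) y1 by (intro mult_right_mono power_mono) auto
    finally have "\<gamma> / 2 * real D powr \<alpha> \<le> ln (real ?N)" using upper by simp
    moreover have "\<gamma> / 2 * V powr \<alpha> \<le> \<gamma> / 2 * real D powr \<alpha>"
      using VD V0 \<alpha> \<gamma> by (intro mult_left_mono powr_mono2) auto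
    ultimately have "\<gamma> / 2 * V powr \<alpha> \<le> ln (real ?N)" by linarith
    then show ?thesis using \<gamma> by (simp add: field_simps)
  qed
  show ?thesis
    using A \<gamma> main
    by (intro exI[of _ "max (real A) x0"] exI[of _ "2 / \<gamma>"] conjI allI impI)
      (auto simp: d_def \<alpha>_def)
qed

end
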